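(* For a natural number $n$, let $L'_n := \{d : d \mid n,\ \sqrt{n} \le d \le n\}$ be the set of large divisors of $n$. For $x>0$, let $f(x)$ be the number of natural numbers $n \le x$ such that $L'_n$ forms an arithmetic progression. Then, as $x \to \infty$, $$f(x)\ \sim\ \frac{x\log\log x}{\log x}.$$
   Context: Natural numbers are positive integers. A finite set $S$ of natural numbers forms an arithmetic progression if $S = \{d, d+a, d+2a, \ldots, d+(k-1)a\}$ for some natural numbers $d, a, k$; the empty set is regarded as vacuously forming an arithmetic progression. (In particular, every set with one or two elements forms an arithmetic progression.) The notation $f(x) \sim g(x)$ as $x\to\infty$ means $\lim_{x\to\infty} f(x)/g(x) = 1$, and $\log$ is the natural logarithm. *)

theory Defs
  imports Complex_Main "HOL-Library.Landau_Symbols"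
begin

(* Natural numbers are positive here, hence the conditions 0 < d, 0 < a, 0 < k
   (and 0 < n in the counting function below). *)
definition forms_AP :: "nat set \<Rightarrow> bool" where
  "forms_AP S \<longleftrightarrow>
     S = {} \<or> (\<exists>d a k. 0 < d \<and> 0 < a \<and> 0 < k \<and> S = {d + i * a | i. i < k})"

definition large_divisors :: "nat \<Rightarrow> nat set" where
  "large_divisors n = {d. d dvd n \<and> sqrt (real n) \<le> real d \<and> d \<le> n}"

definition count_large_AP :: "real \<Rightarrow> nat" where
  "count_large_AP x = card {n. 0 < n \<and> real n \<le> x \<and> forms_AP (large_divisors n)}"

end

theory Submission
  imports Defs "HOL-Complex_Analysis.Complex_Analysis" "HOL-Number_Theory.Number_Theory"
    "HOL-Real_Asymp.Real_Asymp"
begin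

text \<open>
  Suppose that the large divisors of n form a progression with difference a and at least three
  terms. Its largest terms are n, n - a and n - 2a. As a proper divisor, n - a is at most n/2, so
  a is at least n/2 and n - 2a is not positive, which is absurd. Hence n has at most two large
  divisors, and this leaves only 1, p, p^2, p^3 and pq with primes p < q. Conversely the large
  divisors of pq are q and pq. Primes, their squares and their cubes up to x number
  at most 3 \<pi>(x) together, which is negligible (lemma \<open>count_large_AP_bounds\<close>), so the claim is
  Landau's asymptotic formula for the products of two distinct primes up to x.

  Counting pq by its smaller factor gives the sum of \<pi>(x/p) - \<pi>(p) over primes p up to
  sqrt x. The prime number theorem turns \<pi>(x/p) into x / (p ln (x/p)). For most of the mass of
  the sum of 1/p the logarithm ln (x/p) is close to ln x, and the sum of 1/p over primes up to x
  is asymptotic to ln (ln x); this yields x ln (ln x) / ln x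
  (theorems \<open>prime_count_sum_asymp\<close> and \<open>semiprimes_asymp\<close>).

  The prime number theorem is proved along the lines of Newman and Zagier. With
  \<psi>(n) denoting the sum of the von Mangoldt function up to n, it suffices that the series with terms
  (\<psi>(n) - n) / (n (n + 1)) converges: an excess \<psi>(n) > c n with c > 1 would persist on a range
  of length proportional to n and contribute a fixed amount to the series, and likewise for a
  deficit (\<open>mono_ratio_tendsto_1\<close>). By partial summation,
  (- zeta'/zeta - zeta)(s) / s is for Re s > 1 the sum of \<psi>(n) - n times the
  integral of t powr (- s - 1) over [n, n + 1] (\<open>psi_error_sums\<close>), so the convergence wanted is
  that of this expansion at the boundary point s = 1. It follows from Newman's Tauberian theorem
  (\<open>newman_tauberian\<close>), whose hypotheses are Chebyshev's bound \<psi>(n) = O(n)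
  (\<open>chebyshev_psi_le\<close>) and the holomorphy of the function across the line Re s = 1, that is,
  that zeta has no zeros there (\<open>zeta_pole_nonzero\<close>).
\<close>

section \<open>Contour integrals over a half circle closed on the left\<close>

text \<open>Off the nonnegative real axis Ln (- z) is a primitive of 1/z, so only the end points of the path
matter. Together with the mirror image below this spares any computation of winding numbers.\<close>
lemma has_contour_integral_inverse_left:
  assumes "valid_path g" "path_image g \<subseteq> {z. Re z \<le> 0} - {0}"
    and "pathstart g = \<i> * of_real R" "pathfinish g = - (\<i> * of_real R)" "R > 0"
  shows "((\<lambda>z. 1 / z) has_contour_integral (pi * \<i>)) g"
proof -
  have *: "((\<lambda>z. Ln (-z)) has_field_derivative 1 / z) (at z within {z. Re z \<le> 0} - {0})"
    if "z \<in> {z. Re z \<le> 0} - {0}" for z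
  proof -
    have "- z \<notin> \<real>\<^sub>\<le>\<^sub>0" 
      using that by (auto simp: complex_nonpos_Reals_iff complex_eq_iff)
    then show ?thesis using that
      by (auto intro!: derivative_eq_intros simp: field_simps)
  qed
  have "((\<lambda>z. 1 / z) has_contour_integral (Ln (- pathfinish g) - Ln (- pathstart g))) g"
    by (rule contour_integral_primitive[OF *]) (use assms in auto)
  moreover have "Ln (\<i> * of_real R) = ln R + \<i> * pi / 2"
    using Ln_times_of_real[of R \<i>] assms by (simp add: mult.commute Ln_of_real)
  moreover have "Ln (- (\<i> * of_real R)) = ln R - \<i> * pi / 2"
    using Ln_times_of_real[of R "-\<i>"] assms by (simp add: mult.commute Ln_of_real)
  ultimately show ?thesis
    using assms by (simp add: field_simps)
qed

lemma has_contour_integral_inverse_right: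
  assumes "valid_path g" "path_image g \<subseteq> {z. Re z \<ge> 0} - {0}"
    and "pathstart g = - (\<i> * of_real R)" "pathfinish g = \<i> * of_real R" "R > 0"
  shows "((\<lambda>z. 1 / z) has_contour_integral (pi * \<i>)) g"
proof -
  have *: "(Ln has_field_derivative 1 / z) (at z within {z. Re z \<ge> 0} - {0})"
    if "z \<in> {z. Re z \<ge> 0} - {0}" for z
  proof -
    have "z \<notin> \<real>\<^sub>\<le>\<^sub>0" 
      using that by (auto simp: complex_nonpos_Reals_iff complex_eq_iff)
    then show ?thesis using that
      by (auto intro!: derivative_eq_intros simp: field_simps)
  qed
  have "((\<lambda>z. 1 / z) has_contour_integral (Ln (pathfinish g) - Ln (pathstart g))) g"
    by (rule contour_integral_primitive[OF *]) (use assms in auto)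
  moreover have "Ln (\<i> * of_real R) = ln R + \<i> * pi / 2"
    using Ln_times_of_real[of R \<i>] assms by (simp add: mult.commute Ln_of_real)
  moreover have "Ln (- (\<i> * of_real R)) = ln R - \<i> * pi / 2"
    using Ln_times_of_real[of R "-\<i>"] assms by (simp add: mult.commute Ln_of_real)
  ultimately show ?thesis
    using assms by (simp add: field_simps)
qed

definition right_arc :: "real \<Rightarrow> real \<Rightarrow> complex" where
  "right_arc R = part_circlepath 0 R (-(pi/2)) (pi/2)"

definition left_arc :: "real \<Rightarrow> real \<Rightarrow> complex" where
  "left_arc R = part_circlepath 0 R (pi/2) (3*pi/2)"

lemma path_image_right_arc:
  assumes "z \<in> path_image (right_arc R)" "R > 0"
  shows "norm z = R" "Re z \<ge> 0"
proof -
  obtain x where x: "z = R * exp (\<i> * of_real x)" "-(pi/2) \<le> x" "x \<le> pi/2"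
    using assms by (auto simp: right_arc_def path_image_part_circlepath)
  show "norm z = R" using x assms by (simp add: norm_mult)
  show "Re z \<ge> 0" using x assms by (simp add: Re_exp cos_ge_zero)
qed

lemma path_image_left_arc:
  assumes "z \<in> path_image (left_arc R)" "R > 0"
  shows "norm z = R" "Re z \<le> 0"
proof -
  obtain x where x: "z = R * exp (\<i> * of_real x)" "pi/2 \<le> x" "x \<le> 3*pi/2"
    using assms by (auto simp: left_arc_def path_image_part_circlepath)
  show "norm z = R" using x assms by (simp add: norm_mult)
  have "cos (x - pi) \<ge> 0" using x by (intro cos_ge_zero) auto
  then show "Re z \<le> 0" using x assms by (simp add: Re_exp mult_nonneg_nonpos)
qed

lemma arc_ends:
  "pathstart (right_arc R) = - (\<i> * of_real R)" "pathfinish (right_arc R) = \<i> * of_real R"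
  "pathstart (left_arc R) = \<i> * of_real R" "pathfinish (left_arc R) = - (\<i> * of_real R)"
proof -
  have "3*pi/2 = pi/2 + pi" by simp
  then have "cos (3*pi/2) = 0" "sin (3*pi/2) = -1"
    by (simp_all only: cos_add sin_add) simp_all
  then show "pathstart (right_arc R) = - (\<i> * of_real R)" "pathfinish (right_arc R) = \<i> * of_real R"
  "pathstart (left_arc R) = \<i> * of_real R" "pathfinish (left_arc R) = - (\<i> * of_real R)"
    by (auto simp: right_arc_def left_arc_def complex_eq_iff Re_exp Im_exp cos_add sin_add)
qed

text \<open>Cauchy's formula at 0 for a closed path whose right half is a half circle and whose left half is
an arbitrary path g. The winding number is 1 because each half contributes pi i to the integral of 1/z.
It is used twice: with the left half circle for entire functions, and with a path that stays close
to the imaginary axis for a function that is only known to be holomorphic near the half plane.\<close>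
lemma cauchy_right_arc:
  assumes "convex K" "0 \<in> interior K" "H holomorphic_on K" "R > 0"
    and "path_image (right_arc R) \<subseteq> K"
    and g: "valid_path g" "path_image g \<subseteq> K" "path_image g \<subseteq> {z. Re z \<le> 0} - {0}"
      "pathstart g = \<i> * of_real R" "pathfinish g = - (\<i> * of_real R)"
  shows "(\<lambda>z. H z / z) contour_integrable_on right_arc R"
    and "(\<lambda>z. H z / z) contour_integrable_on g"
    and "contour_integral (right_arc R) (\<lambda>z. H z / z) + contour_integral g (\<lambda>z. H z / z)
           = 2 * pi * \<i> * H 0"
proof -
  let ?A = "right_arc R"
  let ?G = "?A +++ g"
  have vA: "valid_path ?A" by (simp add: right_arc_def)
  have ends: "pathfinish ?A = pathstart g" using g by (simp add: arc_ends)
  have vG: "valid_path ?G" using vA g ends by (intro valid_path_join)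
  have A0: "path_image ?A \<subseteq> {z. Re z \<ge> 0} - {0}"
    using path_image_right_arc[OF _ \<open>R > 0\<close>] \<open>R > 0\<close> by fastforce
  have pG: "path_image ?G \<subseteq> K - {0}"
    using A0 assms(5) g by (subst path_image_join[OF ends]) auto
  have cl: "pathfinish ?G = pathstart ?G" using g by (simp add: arc_ends)
  have formula: "((\<lambda>w. f w / w) has_contour_integral (2*pi * \<i> * winding_number ?G 0 * f 0)) ?G"
    if "f holomorphic_on K" for f
    using Cauchy_integral_formula_convex_simple[OF assms(1) that assms(2) vG pG cl] by simp
  have one: "((\<lambda>w. 1 / w) has_contour_integral (pi * \<i> + pi * \<i>)) ?G"
    by (intro has_contour_integral_join has_contour_integral_inverse_right[where R=R]
         has_contour_integral_inverse_left[where R=R] vA g A0) (use arc_ends \<open>R > 0\<close> in auto)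
  have "2*pi * \<i> * winding_number ?G 0 = pi * \<i> + pi * \<i>"
    using has_contour_integral_unique[OF formula[of "\<lambda>_. 1"] one] by simp
  then have wn: "winding_number ?G 0 = 1" by (simp add: field_simps)
  have H: "((\<lambda>w. H w / w) has_contour_integral (2*pi * \<i> * H 0)) ?G"
    using formula[OF assms(3)] wn by simp
  then have "(\<lambda>w. H w / w) contour_integrable_on ?G" by (rule has_contour_integral_integrable)
  then show 1: "(\<lambda>z. H z / z) contour_integrable_on ?A" "(\<lambda>z. H z / z) contour_integrable_on g"
    using vA g ends by (auto simp: contour_integrable_join)
  show "contour_integral ?A (\<lambda>z. H z / z) + contour_integral g (\<lambda>z. H z / z) = 2 * pi * \<i> * H 0"
    using contour_integral_unique[OF H] contour_integral_join[OF 1 vA g(1)] by simp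
qed

text \<open>The exponential decay along the segment supplies the factor 1/c, which tends to 0 in the
application as the decay rate c grows.\<close>
lemma linepath_decay_bound:
  fixes f :: "complex \<Rightarrow> complex"
  assumes f: "f contour_integrable_on linepath a b" and c: "c > 0"
    and le: "\<And>t. 0 \<le> t \<Longrightarrow> t \<le> 1 \<Longrightarrow> norm (f (linepath a b t)) \<le> M * exp (- (c * t))"
  shows "norm (contour_integral (linepath a b) f) \<le> M * norm (b - a) / c"
proof -
  have int: "(\<lambda>t. f (linepath a b t) * (b - a)) integrable_on {0..1}"
    using f by (simp add: contour_integrable_on)
  have "((\<lambda>t. M * norm (b - a) * exp (-(c*t))) has_integral
         (- (M * norm (b - a) / c * exp (-(c*1))) - - (M * norm (b - a) / c * exp (-(c*0))))) {0..1}"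
    by (rule fundamental_theorem_of_calculus)
      (use c in \<open>auto intro!: derivative_eq_intros simp: field_simps
          simp flip: has_real_derivative_iff_has_vector_derivative\<close>)
  then have E: "((\<lambda>t. M * norm (b - a) * exp (-(c*t))) has_integral
         M * norm (b - a) / c * (1 - exp (-c))) {0..1}" (is "(?e has_integral ?v) _")
    by (simp add: algebra_simps diff_divide_distrib)
  have "0 \<le> norm (f (linepath a b 0))" by simp
  also have "\<dots> \<le> M * exp (-(c*0))" by (rule le) auto
  finally have M: "M \<ge> 0" by simp
  have "norm (contour_integral (linepath a b) f) = norm (integral {0..1} (\<lambda>t. f (linepath a b t) * (b - a)))"
    by (simp add: contour_integral_integral)
  also have "\<dots> \<le> integral {0..1} ?e"
  proof (rule integral_norm_bound_integral[OF int])
    show "?e integrable_on {0..1}" using E by blast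
    fix t :: real assume "t \<in> {0..1}"
    then show "norm (f (linepath a b t) * (b - a)) \<le> ?e t"
      using mult_right_mono[OF le[of t], of "norm (b - a)"] by (simp add: norm_mult mult_ac)
  qed
  also have "\<dots> = ?v" using E by (rule integral_unique)
  also have "\<dots> \<le> M * norm (b - a) / c * 1"
    by (intro mult_left_mono) (use M c in auto)
  finally show ?thesis by simp
qed

text \<open>Newman's device: besides the exponential, the factor 1 + z^2/R^2 takes the value 1 at 0 and makes
the kernel divided by z vanish at the points iR and - iR, where the bounds for the series blow up.\<close>
definition newman_kernel :: "real \<Rightarrow> real \<Rightarrow> complex \<Rightarrow> complex" where
  "newman_kernel R L z = exp (of_real L * z) * (1 + z\<^sup>2 / of_real (R\<^sup>2))"

lemma newman_kernel_0 [simp]: "newman_kernel R L 0 = 1"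
  by (simp add: newman_kernel_def)

lemma newman_kernel_holomorphic [holomorphic_intros]: 
  "newman_kernel R L holomorphic_on S"
  unfolding newman_kernel_def by (cases "R = 0") (auto intro!: holomorphic_intros)

text \<open>On the circle z cnj z = R^2, so (1 + z^2/R^2) / z is the real number 2 Re z / R^2.\<close>
lemma norm_newman_kernel:
  assumes "norm z = R" "R > 0"
  shows "norm (newman_kernel R L z / z) = exp (L * Re z) * (2 * \<bar>Re z\<bar> / R\<^sup>2)"
proof -
  have z: "z * cnj z = of_real (R\<^sup>2)" using complex_norm_square[of z] assms by simp
  have z0: "z \<noteq> 0" using assms by auto
  have "(1 + z\<^sup>2 / of_real (R\<^sup>2)) / z = (z * cnj z + z\<^sup>2) / (of_real (R\<^sup>2) * z)"
    using z0 assms unfolding z by (simp add: field_simps)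
  also have "\<dots> = (z * (cnj z + z)) / (z * of_real (R\<^sup>2))"
    by (simp add: algebra_simps power2_eq_square)
  also have "\<dots> = (cnj z + z) / of_real (R\<^sup>2)" using z0 by (rule mult_divide_mult_cancel_left)
  also have "\<dots> = of_real (2 * Re z / R\<^sup>2)" by (simp add: complex_eq_iff)
  finally have "norm ((1 + z\<^sup>2 / of_real (R\<^sup>2)) / z) = 2 * \<bar>Re z\<bar> / R\<^sup>2" 
    by (simp only: norm_of_real) (simp add: abs_mult)
  moreover have "newman_kernel R L z / z = exp (of_real L * z) * ((1 + z\<^sup>2 / of_real (R\<^sup>2)) / z)"
    by (simp add: newman_kernel_def)
  ultimately show ?thesis by (simp only: norm_mult) simp
qed

lemma imaginary_axis_on_arc:
  assumes "norm z = R" "Re z = 0"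
  shows "z \<in> {\<i> * of_real R, - (\<i> * of_real R)}"
proof -
  have "\<bar>Im z\<bar> = R" using assms by (simp add: cmod_def)
  then show ?thesis using assms by (auto simp: complex_eq_iff abs_if split: if_splits)
qed

text \<open>The points on the imaginary axis are the end points of the arcs and may be ignored; this matters
because the bounds for the series hold only where Re z is not 0.\<close>
lemma arc_bounds:
  assumes R: "R > 0" and C: "C \<ge> 0"
  shows "f contour_integrable_on right_arc R \<Longrightarrow>
     (\<And>z. norm z = R \<Longrightarrow> Re z > 0 \<Longrightarrow> norm (f z) \<le> 2 * C / R\<^sup>2) \<Longrightarrow>
     norm (contour_integral (right_arc R) f) \<le> 2 * pi * C / R"
   and "f contour_integrable_on left_arc R \<Longrightarrow>
     (\<And>z. norm z = R \<Longrightarrow> Re z < 0 \<Longrightarrow> norm (f z) \<le> 2 * C / R\<^sup>2) \<Longrightarrow>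
     norm (contour_integral (left_arc R) f) \<le> 2 * pi * C / R"
proof -
  let ?X = "{\<i> * of_real R, - (\<i> * of_real R)}"
  assume f: "f contour_integrable_on right_arc R"
    "\<And>z. norm z = R \<Longrightarrow> Re z > 0 \<Longrightarrow> norm (f z) \<le> 2 * C / R\<^sup>2"
  have "norm (f z) \<le> 2 * C / R\<^sup>2" if "z \<in> path_image (right_arc R) - ?X" for z
    using that path_image_right_arc[of z R] imaginary_axis_on_arc[of z R] R f(2)[of z] by force
  note bnd = this[unfolded right_arc_def]
  have "norm (contour_integral (right_arc R) f) \<le> 2 * C / R\<^sup>2 * R * (pi/2 - -(pi/2))"
    unfolding right_arc_def
    by (rule has_contour_integral_bound_part_circlepath_strong[where k="?X", OF
        has_contour_integral_integral[OF f(1)[unfolded right_arc_def]]]) (use R C bnd in auto)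
  also have "\<dots> = 2 * pi * C / R" using R by (simp add: field_simps power2_eq_square)
  finally show "norm (contour_integral (right_arc R) f) \<le> 2 * pi * C / R" .
next
  let ?X = "{\<i> * of_real R, - (\<i> * of_real R)}"
  assume f: "f contour_integrable_on left_arc R"
    "\<And>z. norm z = R \<Longrightarrow> Re z < 0 \<Longrightarrow> norm (f z) \<le> 2 * C / R\<^sup>2"
  have "norm (f z) \<le> 2 * C / R\<^sup>2" if "z \<in> path_image (left_arc R) - ?X" for z
    using that path_image_left_arc[of z R] imaginary_axis_on_arc[of z R] R f(2)[of z] by force
  note bnd = this[unfolded left_arc_def]
  have "norm (contour_integral (left_arc R) f) \<le> 2 * C / R\<^sup>2 * R * (3*pi/2 - pi/2)"
    unfolding left_arc_def
    by (rule has_contour_integral_bound_part_circlepath_strong[where k="?X", OF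
        has_contour_integral_integral[OF f(1)[unfolded left_arc_def]]]) (use R C bnd in auto)
  also have "\<dots> = 2 * pi * C / R" using R by (simp add: field_simps power2_eq_square)
  finally show "norm (contour_integral (left_arc R) f) \<le> 2 * pi * C / R" .
qed

section \<open>Newman's Tauberian theorem\<close>

text \<open>The terms are modelled on integrals of f(t) exp (- t z) over [l n, l (n + 1)] with f bounded by C:
the bound on w n z is what the triangle inequality gives for such an integral, and it telescopes.
Write s N for the N-th partial sum and L for l N. Cauchy's formula expresses F 0 - s N 0 by the
integrals of (F - s N) times the kernel over the right arc, of s N over the left arc, and of F over a
path in Re z < 0. On the arcs the factor 2 |Re z| exp (L Re z) / R^2 of the kernel cancels the bound
C exp (- L Re z) / |Re z| for the tail or the partial sum, so each contributes O(C/R) uniformly in N;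
the remaining integral tends to 0 for fixed R as L grows.\<close>
theorem newman_tauberian:
  fixes w :: "nat \<Rightarrow> complex \<Rightarrow> complex" and l :: "nat \<Rightarrow> real"
  assumes hol: "\<And>n. w n holomorphic_on UNIV"
    and l0: "l 0 = 0" and linf: "filterlim l at_top sequentially" and C: "C \<ge> 0"
    and bd: "\<And>n z. Re z \<noteq> 0 \<Longrightarrow>
      norm (w n z) \<le> C * (exp (-(l n * Re z)) - exp (-(l (Suc n) * Re z))) / Re z"
    and F: "F holomorphic_on S" "open S" "{z. Re z \<ge> 0} \<subseteq> S"
    and sums: "\<And>z. Re z > 0 \<Longrightarrow> (\<lambda>n. w n z) sums F z"
  shows "(\<lambda>n. w n 0) sums F 0"
proof -
  define s where "s = (\<lambda>N z. \<Sum>n<N. w n z)"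
  have s_hol: "s N holomorphic_on A" for N A
    unfolding s_def using hol by (auto intro!: holomorphic_intros intro: holomorphic_on_subset)
  have tele: "norm (s M z - s N z) \<le> C * (exp (-(l N * Re z)) - exp (-(l M * Re z))) / Re z"
    if "N \<le> M" "Re z \<noteq> 0" for M N z
    using that(1)
  proof (induction M rule: dec_induct)
    case (step M)
    have "norm (s (Suc M) z - s N z) \<le> norm (s M z - s N z) + norm (w M z)"
      using norm_triangle_ineq[of "s M z - s N z" "w M z"] by (simp add: s_def algebra_simps)
    also have "\<dots> \<le> C * (exp (-(l N * Re z)) - exp (-(l M * Re z))) / Re z
        + C * (exp (-(l M * Re z)) - exp (-(l (Suc M) * Re z))) / Re z"
      using step.IH bd[of z M] that by linarith
    also have "\<dots> = C * (exp (-(l N * Re z)) - exp (-(l (Suc M) * Re z))) / Re z"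
      by (simp add: algebra_simps diff_divide_distrib)
    finally show ?case .
  qed simp
  have left: "norm (s N z) \<le> C * exp (-(l N * Re z)) / \<bar>Re z\<bar>" if "Re z < 0" for N z
  proof -
    have "norm (s N z) \<le> C * (1 - exp (-(l N * Re z))) / Re z"
      using tele[of 0 N z] that by (simp add: l0 s_def)
    also have "\<dots> = (C * exp (-(l N * Re z)) - C) / \<bar>Re z\<bar>"
      using that by (simp add: field_simps)
    also have "\<dots> \<le> C * exp (-(l N * Re z)) / \<bar>Re z\<bar>"
      using C by (intro divide_right_mono) auto
    finally show ?thesis .
  qed
  have right: "norm (F z - s N z) \<le> C * exp (-(l N * Re z)) / \<bar>Re z\<bar>" if "Re z > 0" for N z
  proof (rule tendsto_upperbound)
    have "(\<lambda>M. s M z) \<longlonglongrightarrow> F z" using sums[OF that] by (simp add: sums_def s_def)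
    then show "(\<lambda>M. norm (s M z - s N z)) \<longlonglongrightarrow> norm (F z - s N z)" by (intro tendsto_intros)
    show "\<forall>\<^sub>F M in sequentially. norm (s M z - s N z) \<le> C * exp (-(l N * Re z)) / \<bar>Re z\<bar>"
      using eventually_ge_at_top[of N]
    proof eventually_elim
      case (elim M)
      have "norm (s M z - s N z) \<le> C * (exp (-(l N * Re z)) - exp (-(l M * Re z))) / Re z"
        using tele elim that by simp
      also have "\<dots> \<le> C * exp (-(l N * Re z)) / \<bar>Re z\<bar>"
        using that C by (auto intro!: divide_right_mono mult_left_mono)
      finally show ?case .
    qed
  qed simp
  have "\<forall>\<^sub>F N in sequentially. norm (s N 0 - F 0) < e" if e: "e > 0" for e
  proof -
    \<comment> \<open>The two arcs contribute 2 C / R altogether, which has to stay below e / 2.\<close>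
    define R where "R = 4 * C / e + 1"
    have R: "R > 0" "2 * C / R < e / 2"
      using C e by (auto simp: R_def field_simps intro: add_nonneg_pos)
    have "compact (cball 0 (2 * R) \<inter> {z. Re z \<ge> 0})"
      by (intro compact_Int_closed compact_cball closed_halfspace_Re_ge)
    moreover have "cball 0 (2 * R) \<inter> {z. Re z \<ge> 0} \<subseteq> S" using F by auto
    ultimately obtain d0 where d0: "d0 > 0" "(\<Union>x\<in>cball 0 (2 * R) \<inter> {z. Re z \<ge> 0}. ball x d0) \<subseteq> S"
      using compact_subset_open_imp_ball_epsilon_subset[OF _ F(2)] by metis
    \<comment> \<open>By compactness the half disc can be thickened to the left within S; the cap R keeps the thickened
region inside the larger disc.\<close>
    define d where "d = min (d0 / 2) R"
    have d: "d > 0" "d < d0" "d \<le> R" using d0 R by (auto simp: d_def)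
    define K where "K = cball 0 (2 * R) \<inter> {z. Re z \<ge> - d}"
    have K_S: "K \<subseteq> S"
    proof
      fix z assume z: "z \<in> K"
      show "z \<in> S"
      proof (cases "Re z \<ge> 0")
        case False
        have "\<bar>Im z\<bar> \<le> 2 * R" using z abs_Im_le_cmod[of z] by (auto simp: K_def)
        then have "\<i> * of_real (Im z) \<in> cball 0 (2 * R) \<inter> {z. Re z \<ge> 0}"
          by (auto simp: norm_mult)
        moreover have "dist (\<i> * of_real (Im z)) z = \<bar>Re z\<bar>"
          by (simp add: dist_norm cmod_def)
        then have "z \<in> ball (\<i> * of_real (Im z)) d0"
          using z d False by (auto simp: K_def)
        ultimately show ?thesis using d0 by blast
      qed (use F in auto)
    qed
    have K_conv: "convex K" unfolding K_def by (intro convex_Int convex_cball convex_halfspace_Re_ge)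
    have K_int: "0 \<in> interior K"
    proof (rule interiorI)
      show "open (ball 0 (2*R) \<inter> {z. Re z > - d})"
        by (intro open_Int open_ball open_halfspace_Re_gt)
    qed (use R d in \<open>auto simp: K_def\<close>)
    have FK: "F holomorphic_on K" using F K_S holomorphic_on_subset by blast
    have AK: "path_image (right_arc R) \<subseteq> K"
      using path_image_right_arc[of _ R] R d by (fastforce simp: K_def)
    \<comment> \<open>Two segments through - d close the contour; Re z decreases linearly along them away from the imaginary axis.\<close>
    let ?b1 = "linepath (\<i> * of_real R) (- of_real d)"
    let ?b2 = "linepath (- of_real d) (- (\<i> * of_real R))"
    let ?b2' = "linepath (- (\<i> * of_real R)) (- of_real d)"
    define X where "X = path_image ?b1 \<union> path_image ?b2"
    have Xpt: "z \<in> K \<and> Re z \<le> 0 \<and> z \<noteq> 0" if "z \<in> X" for z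
    proof -
      have "\<i> * of_real R \<in> K" "- of_real d \<in> K" "- (\<i> * of_real R) \<in> K"
        using R d by (auto simp: K_def norm_mult)
      then have "path_image ?b1 \<subseteq> K" "path_image ?b2 \<subseteq> K"
        using K_conv by (simp_all add: closed_segment_subset)
      then have "z \<in> K" using that by (auto simp only: X_def)
      moreover from that obtain t where t: "0 \<le> t" "t \<le> 1" 
        and z: "z = linepath (\<i> * of_real R) (- of_real d) t \<or> z = linepath (- of_real d) (- (\<i> * of_real R)) t"
        by (auto simp: X_def path_image_def)
      have "Re z \<le> 0" using z t d by (auto simp: linepath_def mult_nonneg_nonpos)
      moreover have "z \<noteq> 0" using z t d R by (auto simp: linepath_def complex_eq_iff)
      ultimately show ?thesis by blast
    qed
    have "compact ((\<lambda>z. F z * (1 + z\<^sup>2 / of_real (R\<^sup>2)) / z) ` X)"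
    proof (intro compact_continuous_image)
      show "compact X" by (auto simp: X_def)
      show "continuous_on X (\<lambda>z. F z * (1 + z\<^sup>2 / of_real (R\<^sup>2)) / z)"
      proof -
        have "continuous_on X F"
          by (rule continuous_on_subset[OF holomorphic_on_imp_continuous_on[OF FK]]) (use Xpt in auto)
        then show ?thesis using Xpt R by (intro continuous_intros) auto
      qed
    qed
    then have "bounded ((\<lambda>z. F z * (1 + z\<^sup>2 / of_real (R\<^sup>2)) / z) ` X)" 
      by (rule compact_imp_bounded)
    then obtain M where M0: "M > 0" "\<forall>y\<in>(\<lambda>z. F z * (1 + z\<^sup>2 / of_real (R\<^sup>2)) / z) ` X. norm y \<le> M"
      unfolding bounded_pos by (elim exE conjE)
    note M = M0(1) M0(2)[rule_format, OF imageI]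
    define g where "g = ?b1 +++ ?b2"
    have g: "valid_path g" "path_image g = X" "pathstart g = \<i> * of_real R"
      "pathfinish g = - (\<i> * of_real R)"
      unfolding g_def X_def by (auto intro!: valid_path_join simp: path_image_join)
    define D where "D = M * (R + d) / d"
    have main: "norm (F 0 - s N 0) \<le> 2 * C / R + D / l N" if N: "l N > 0" for N
    proof -
      let ?k = "newman_kernel R (l N)"
      let ?A = "right_arc R"
      have h1: "(\<lambda>z. F z * ?k z / z) contour_integrable_on ?A"
           "(\<lambda>z. F z * ?k z / z) contour_integrable_on g"
           "contour_integral ?A (\<lambda>z. F z * ?k z / z) + contour_integral g (\<lambda>z. F z * ?k z / z)
             = 2 * pi * \<i> * F 0"
        using cauchy_right_arc[OF K_conv K_int 
            holomorphic_on_mult[OF FK newman_kernel_holomorphic] R(1) AK g(1) _ _ g(3,4)] g(2) Xpt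
        by (auto simp: subset_iff)
      have h2: "(\<lambda>z. s N z * ?k z / z) contour_integrable_on ?A"
           "(\<lambda>z. s N z * ?k z / z) contour_integrable_on left_arc R"
           "contour_integral ?A (\<lambda>z. s N z * ?k z / z) + contour_integral (left_arc R) (\<lambda>z. s N z * ?k z / z)
             = 2 * pi * \<i> * s N 0"
      proof -
        have "path_image (left_arc R) \<subseteq> {z. Re z \<le> 0} - {0}"
          using path_image_left_arc[OF _ R(1)] R by fastforce
        moreover have v: "valid_path (left_arc R)" by (simp add: left_arc_def)
        ultimately show "(\<lambda>z. s N z * ?k z / z) contour_integrable_on ?A"
           "(\<lambda>z. s N z * ?k z / z) contour_integrable_on left_arc R"
           "contour_integral ?A (\<lambda>z. s N z * ?k z / z) + contour_integral (left_arc R) (\<lambda>z. s N z * ?k z / z)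
             = 2 * pi * \<i> * s N 0"
          using cauchy_right_arc[OF convex_UNIV _ 
            holomorphic_on_mult[OF s_hol newman_kernel_holomorphic] R(1) _ v] 
          by (auto simp: arc_ends)
      qed
      let ?I1 = "contour_integral ?A (\<lambda>z. F z * ?k z / z - s N z * ?k z / z)"
      let ?I2 = "contour_integral (left_arc R) (\<lambda>z. s N z * ?k z / z)"
      let ?I3 = "contour_integral g (\<lambda>z. F z * ?k z / z)"
      have "?I1 = contour_integral ?A (\<lambda>z. F z * ?k z / z) - contour_integral ?A (\<lambda>z. s N z * ?k z / z)"
        by (rule contour_integral_diff[OF h1(1) h2(1)])
      then have eq: "2 * pi * \<i> * (F 0 - s N 0) = ?I1 - ?I2 + ?I3"
        unfolding right_diff_distrib[of "2 * pi * \<i>"] h1(3)[symmetric] h2(3)[symmetric] by simp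
      \<comment> \<open>The exponentials and the factor Re z of the kernel cancel exactly.\<close>
      have b: "C * exp (-(l N * Re z)) / \<bar>Re z\<bar> * norm (?k z / z) = 2 * C / R\<^sup>2"
        if "norm z = R" "Re z \<noteq> 0" for z
        unfolding norm_newman_kernel[OF that(1) R(1)] using that R
        by (simp add: exp_minus field_simps)
      have n1: "norm ?I1 \<le> 2 * pi * C / R"
      proof (rule arc_bounds(1)[OF R(1) C])
        show "(\<lambda>z. F z * ?k z / z - s N z * ?k z / z) contour_integrable_on ?A"
          by (rule contour_integrable_diff[OF h1(1) h2(1)])
        fix z :: complex assume z: "norm z = R" "Re z > 0"
        have "norm (F z * ?k z / z - s N z * ?k z / z) = norm (F z - s N z) * norm (?k z / z)"
          unfolding norm_mult[symmetric] by (simp add: algebra_simps diff_divide_distrib)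
        also have "\<dots> \<le> C * exp (-(l N * Re z)) / \<bar>Re z\<bar> * norm (?k z / z)"
          by (intro mult_right_mono right z norm_ge_zero)
        finally show "norm (F z * ?k z / z - s N z * ?k z / z) \<le> 2 * C / R\<^sup>2"
          using b[of z] z by simp
      qed
      have n2: "norm ?I2 \<le> 2 * pi * C / R"
      proof (rule arc_bounds(2)[OF R(1) C h2(2)])
        fix z :: complex assume z: "norm z = R" "Re z < 0"
        have "norm (s N z * ?k z / z) = norm (s N z) * norm (?k z / z)"
          unfolding norm_mult[symmetric] by simp
        also have "\<dots> \<le> C * exp (-(l N * Re z)) / \<bar>Re z\<bar> * norm (?k z / z)"
          by (intro mult_right_mono left z norm_ge_zero)
        finally show "norm (s N z * ?k z / z) \<le> 2 * C / R\<^sup>2"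
          using b[of z] z by simp
      qed
      have bX: "norm (F z * ?k z / z) \<le> M * exp (l N * Re z)" if "z \<in> X" for z
      proof -
        have "norm (F z * ?k z / z) = norm (F z * (1 + z\<^sup>2 / of_real (R\<^sup>2)) / z) * norm (exp (of_real (l N) * z))"
          unfolding norm_mult[symmetric] by (simp add: newman_kernel_def mult_ac)
        also have "\<dots> \<le> M * exp (l N * Re z)" using M(2)[OF that] by simp
        finally show ?thesis .
      qed
      have lin: "norm (contour_integral (linepath a (- of_real d)) (\<lambda>z. F z * ?k z / z)) \<le> D / l N"
        if a: "norm a = R" "Re a = 0" "path_image (linepath a (- of_real d)) \<subseteq> X"
          "(\<lambda>z. F z * ?k z / z) contour_integrable_on (linepath a (- of_real d))" for a
      proof -
        have "norm (contour_integral (linepath a (- of_real d)) (\<lambda>z. F z * ?k z / z))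
          \<le> M * norm (- of_real d - a) / (l N * d)"
        proof (rule linepath_decay_bound[OF a(4)])
          fix t :: real assume t: "0 \<le> t" "t \<le> 1"
          then have "linepath a (- of_real d) t \<in> X" using a(3) by (auto simp: path_image_def)
          from bX[OF this] show "norm (F (linepath a (- of_real d) t) * ?k (linepath a (- of_real d) t) 
              / linepath a (- of_real d) t) \<le> M * exp (- (l N * d * t))"
            using a(2) by (simp add: linepath_def mult_ac)
        qed (use N d in auto)
        also have "\<dots> \<le> M * (R + d) / (l N * d)"
          using norm_triangle_ineq4[of "- of_real d" a] a N d M
          by (intro divide_right_mono mult_left_mono) auto
        also have "\<dots> = D / l N" by (simp add: D_def field_simps)
        finally show ?thesis .
      qed
      have gi: "(\<lambda>z. F z * ?k z / z) contour_integrable_on ?b1"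
        "(\<lambda>z. F z * ?k z / z) contour_integrable_on ?b2"
        using h1(2) by (auto simp: g_def contour_integrable_join)
      \<comment> \<open>The second segment is reversed so that the decay again starts at the imaginary axis.\<close>
      have gi': "(\<lambda>z. F z * ?k z / z) contour_integrable_on ?b2'"
        using contour_integrable_reversepath[OF _ gi(2)] by simp
      have "?I3 = contour_integral ?b1 (\<lambda>z. F z * ?k z / z) - contour_integral ?b2' (\<lambda>z. F z * ?k z / z)"
        unfolding g_def using gi contour_integral_reversepath[of ?b2 "\<lambda>z. F z * ?k z / z"]
        by (simp add: contour_integral_join)
      moreover have "norm (contour_integral ?b1 (\<lambda>z. F z * ?k z / z)) \<le> D / l N"
        using lin[OF _ _ _ gi(1)] R by (auto simp: norm_mult X_def)
      moreover have "norm (contour_integral ?b2' (\<lambda>z. F z * ?k z / z)) \<le> D / l N"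
        using lin[OF _ _ _ gi'] R by (auto simp: norm_mult X_def closed_segment_commute)
      ultimately have n3: "norm ?I3 \<le> 2 * (D / l N)"
        using norm_triangle_ineq4[of "contour_integral ?b1 (\<lambda>z. F z * ?k z / z)"
            "contour_integral ?b2' (\<lambda>z. F z * ?k z / z)"] by simp
      have "2 * pi * norm (F 0 - s N 0) = norm (2 * pi * \<i> * (F 0 - s N 0))" by (simp add: norm_mult)
      also have "\<dots> \<le> norm ?I1 + norm ?I2 + norm ?I3"
        unfolding eq using norm_triangle_ineq[of "?I1 - ?I2" ?I3] norm_triangle_ineq4[of ?I1 ?I2]
        by linarith
      also have "\<dots> \<le> 2 * pi * (2 * C / R) + 2 * (D / l N)"
      proof -
        have "2 * pi * (2 * C / R) = 2 * pi * C / R + 2 * pi * C / R" by simp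
        then show ?thesis using n1 n2 n3 by linarith
      qed
      also have "2 * (D / l N) \<le> 2 * pi * (D / l N)"
        using pi_ge_two M R d N by (intro mult_right_mono) (auto simp: D_def)
      finally have "2 * pi * norm (F 0 - s N 0) \<le> 2 * pi * (2 * C / R + D / l N)"
        by (simp add: algebra_simps)
      then show ?thesis by (subst (asm) mult_le_cancel_left_pos) auto
    qed
    have "((\<lambda>N. D / l N) \<longlongrightarrow> 0) sequentially"
      by (intro tendsto_divide_0[OF tendsto_const] filterlim_at_top_imp_at_infinity linf)
    then have "\<forall>\<^sub>F N in sequentially. D / l N < e / 2"
      using e by (intro order_tendstoD(2)) auto
    moreover have "\<forall>\<^sub>F N in sequentially. l N > 0"
      using linf by (simp add: filterlim_at_top_dense)
    ultimately show ?thesis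
    proof eventually_elim
      case (elim N)
      have "norm (s N 0 - F 0) \<le> 2 * C / R + D / l N"
        using main[OF elim(2)] by (simp add: norm_minus_commute)
      then show ?case using elim R by linarith
    qed
  qed
  then show ?thesis unfolding sums_def s_def[symmetric]
    by (intro tendstoI) (simp add: dist_norm s_def)
qed

section \<open>Dirichlet series and the logarithmic derivative of zeta\<close>

text \<open>Absolute convergence allows the double series over pairs (d, m) of positive integers to be regrouped
by the product n = d m. The terms with index 0 are excluded because 0 is a multiple of everything.\<close>
lemma sums_dirichlet_product:
  fixes a b :: "nat \<Rightarrow> complex"
  assumes a: "summable (\<lambda>n. norm (a n))" "a 0 = 0" and b: "summable (\<lambda>n. norm (b n))" "b 0 = 0"
  shows "(\<lambda>n. if n = 0 then 0 else \<Sum>d | d dvd n. a d * b (n div d)) sums (suminf a * suminf b)"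
proof -
  let ?P = "{0<..} :: nat set"
  have pos: "(f has_sum suminf f) ?P" if "summable (\<lambda>n. norm (f n))" "f 0 = 0" for f :: "nat \<Rightarrow> 'a::banach"
  proof -
    have "(f has_sum suminf f) UNIV"
      using norm_summable_imp_has_sum[OF that(1)] summable_norm_cancel[OF that(1)] summable_sums by blast
    then show ?thesis using that(2) by (subst has_sum_cong_neutral[where T = UNIV and g = f]) auto
  qed
  have nA: "(\<lambda>n. norm (a n)) summable_on ?P" and nB: "((\<lambda>n. norm (b n)) has_sum (\<Sum>n. norm (b n))) ?P"
    using pos[of "\<lambda>n. norm (a n)"] pos[of "\<lambda>n. norm (b n)"] a b by (auto simp: has_sum_imp_summable)
  let ?f = "\<lambda>(d, m). a d * b m"
  have inner: "((\<lambda>m. norm (a d * b m)) has_sum (norm (a d) * (\<Sum>n. norm (b n)))) ?P" for d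
    unfolding norm_mult by (intro has_sum_cmult_right nB)
  have "(\<lambda>x. norm (?f x)) summable_on (?P \<times> ?P)"
  proof (intro Infinite_Sum.abs_summable_on_Sigma_iff[THEN iffD2] conjI ballI)
    show "(\<lambda>m. norm (?f (d, m))) summable_on ?P" for d
      using inner[of d] by (auto simp: has_sum_imp_summable)
    show "(\<lambda>d. norm (\<Sum>\<^sub>\<infinity>m\<in>?P. norm (?f (d, m)))) summable_on ?P"
    proof -
      have "norm (\<Sum>\<^sub>\<infinity>m\<in>?P. norm (?f (d, m))) = norm (a d) * (\<Sum>n. norm (b n))" for d
        using infsumI[OF inner[of d]] suminf_nonneg[OF b(1)] by simp
      then show ?thesis by (simp add: summable_on_cmult_left nA)
    qed
  qed
  then have "?f summable_on (?P \<times> ?P)" by (rule Infinite_Sum.abs_summable_summable)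
  then obtain S where S: "(?f has_sum S) (?P \<times> ?P)" by (auto simp: summable_on_def)
  have "((\<lambda>d. a d * suminf b) has_sum S) ?P"
    by (rule has_sum_SigmaD[OF S]) (auto intro!: has_sum_cmult_right pos b)
  moreover have "((\<lambda>d. a d * suminf b) has_sum (suminf a * suminf b)) ?P"
    by (intro has_sum_cmult_left pos a)
  ultimately have S_eq: "S = suminf a * suminf b" by (rule has_sum_unique)
  have bij: "bij_betw (\<lambda>(n, d). (d, n div d)) (SIGMA n:?P. {d. d dvd n}) (?P \<times> ?P)"
    by (rule bij_betwI[where g = "\<lambda>(d, m). (d * m, d)"]) (auto intro: Nat.gr0I elim: dvdE)
  have "((\<lambda>x. ?f ((\<lambda>(n, d). (d, n div d)) x)) has_sum S) (SIGMA n:?P. {d. d dvd n})"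
    using S by (subst has_sum_reindex_bij_betw[OF bij])
  then have "((\<lambda>n. \<Sum>d | d dvd n. a d * b (n div d)) has_sum S) ?P"
    by (rule has_sum_SigmaD) (auto intro!: has_sum_finite)
  then have "((\<lambda>n. if n = 0 then 0 else \<Sum>d | d dvd n. a d * b (n div d)) has_sum S) UNIV"
    by (subst has_sum_cong_neutral[where T = ?P and g = "\<lambda>n. \<Sum>d | d dvd n. a d * b (n div d)"]) auto
  then show ?thesis unfolding S_eq by (rule has_sum_imp_sums)
qed

text \<open>The summation may start at n = 0 since 0 powr (- s) = 0.\<close>
definition dirichlet_series :: "(nat \<Rightarrow> complex) \<Rightarrow> complex \<Rightarrow> complex" where
  "dirichlet_series a s = (\<Sum>n. a n * of_nat n powr (- s))"

lemma norm_nat_powr: "norm (of_nat n powr s :: complex) = real n powr Re s"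
  using norm_powr_real_powr[of "of_nat n" s] by (cases "n = 0") auto

lemma dirichlet_series_abs_summable:
  assumes "\<And>\<sigma>. \<sigma> > 1 \<Longrightarrow> summable (\<lambda>n. norm (a n) * real n powr (- \<sigma>))" "Re s > 1"
  shows "summable (\<lambda>n. norm (a n * of_nat n powr (- s)))"
  using assms(1)[OF assms(2)] by (simp add: norm_mult norm_nat_powr)

lemma dirichlet_series_sums:
  assumes "\<And>\<sigma>. \<sigma> > 1 \<Longrightarrow> summable (\<lambda>n. norm (a n) * real n powr (- \<sigma>))" "Re s > 1"
  shows "(\<lambda>n. a n * of_nat n powr (- s)) sums dirichlet_series a s"
  unfolding dirichlet_series_def
  by (rule summable_sums[OF summable_norm_cancel[OF dirichlet_series_abs_summable[OF assms]]])

lemma has_field_derivative_dirichlet_series: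
  assumes a: "\<And>\<sigma>. \<sigma> > 1 \<Longrightarrow> summable (\<lambda>n. norm (a n) * real n powr (- \<sigma>))" and s: "Re s > 1"
  shows "\<exists>d. (\<lambda>n. - of_real (ln (real n)) * a n * of_nat n powr (- s)) sums d \<and>
             (dirichlet_series a has_field_derivative d) (at s)"
proof -
  let ?S = "{s. Re s > 1}"
  let ?f = "\<lambda>n s. a n * of_nat n powr (- s)"
  let ?f' = "\<lambda>n s. - of_real (ln (real n)) * a n * of_nat n powr (- s)"
  have der: "(?f n has_field_derivative ?f' n s) (at s)" for n s
  proof (cases "n = 0")
    case False
    then have "((\<lambda>s. of_nat n powr (- s)) has_field_derivative
        Ln (of_nat n) * of_nat n powr (- s) * (- 1 :: complex)) (at s)"
      by (intro DERIV_chain2[OF has_field_derivative_powr_right]) (auto intro!: derivative_eq_intros)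
    from DERIV_cmult[OF this, of "a n"] False show ?thesis by (simp add: Ln_of_nat mult_ac)
  qed simp
  have op: "open ?S" by (rule open_halfspace_Re_gt)
  have ex: "\<exists>d h. 0 < d \<and> summable h \<and> range h \<subseteq> \<real>\<^sub>\<ge>\<^sub>0 \<and>
      (\<forall>\<^sub>F n in sequentially. \<forall>y\<in>ball x d \<inter> ?S. norm (?f n y) \<le> norm (h n :: complex))" if "x \<in> ?S" for x
  proof -
    define d where "d = (Re x - 1) / 2"
    have d: "d > 0" "Re x - d > 1" using that by (auto simp: d_def field_simps)
    define h where "h = (\<lambda>n. of_real (norm (a n) * real n powr (- (Re x - d))) :: complex)"
    have "norm (?f n y) \<le> norm (h n)" if "y \<in> ball x d" "n > 0" for n y
    proof -
      have "\<bar>Re (x - y)\<bar> < d" using that abs_Re_le_cmod[of "x - y"] by (simp add: dist_norm)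
      then show ?thesis using that
        by (auto simp: h_def norm_mult norm_nat_powr abs_mult intro!: mult_left_mono powr_mono)
    qed
    then have "\<forall>\<^sub>F n in sequentially. \<forall>y\<in>ball x d \<inter> ?S. norm (?f n y) \<le> norm (h n)"
      by (intro eventually_mono[OF eventually_gt_at_top[of "0::nat"]]) auto
    moreover have "summable h" unfolding h_def
      by (intro summable_of_real a d)
    moreover have "range h \<subseteq> \<real>\<^sub>\<ge>\<^sub>0" by (auto simp: h_def)
    ultimately show ?thesis using d by blast
  qed
  obtain g g' where g: "\<And>x. x \<in> ?S \<Longrightarrow> (\<lambda>n. ?f n x) sums g x" "\<And>x. x \<in> ?S \<Longrightarrow> (\<lambda>n. ?f' n x) sums g' x"
     "\<And>x. x \<in> ?S \<Longrightarrow> (g has_field_derivative g' x) (at x)"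
    using series_and_derivative_comparison_complex[OF op der ex] by blast
  have "(dirichlet_series a has_field_derivative g' s) (at s)"
  proof (rule has_field_derivative_transform_within_open[OF g(3) op])
    show "g x = dirichlet_series a x" if "x \<in> ?S" for x
      using sums_unique[OF g(1)[OF that]] by (simp add: dirichlet_series_def)
  qed (use s in auto)
  then show ?thesis using g(2)[of s] s by blast
qed

definition zeta_series :: "complex \<Rightarrow> complex" where
  "zeta_series = dirichlet_series (\<lambda>_. 1)"

definition mangoldt_series :: "complex \<Rightarrow> complex" where
  "mangoldt_series = dirichlet_series mangoldt"

lemma summable_zeta: "\<sigma> > 1 \<Longrightarrow> summable (\<lambda>n. norm (1::complex) * real n powr (- \<sigma>))"
  by (simp add: summable_real_powr_iff)

lemma summable_mangoldt: 
  assumes "\<sigma> > 1"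
  shows "summable (\<lambda>n. norm (mangoldt n :: complex) * real n powr (- \<sigma>))"
proof (rule summable_comparison_test)
  let ?e = "(\<sigma> - 1) / 2"
  have e: "?e > 0" "?e - \<sigma> < -1" using assms by (auto simp: field_simps)
  show "summable (\<lambda>n. real n powr (?e - \<sigma>) / ?e)"
    using e by (intro summable_divide) (simp add: summable_real_powr_iff)
  show "\<exists>N. \<forall>n\<ge>N. norm (norm (mangoldt n :: complex) * real n powr (- \<sigma>)) \<le> real n powr (?e - \<sigma>) / ?e"
  proof (intro exI allI impI)
    fix n :: nat assume n: "n \<ge> 1"
    have "mangoldt n \<le> ln (real n)" using n by (intro mangoldt_le) auto
    also have "\<dots> \<le> real n powr ?e / ?e" using n e by (intro ln_powr_bound) auto
    finally have "mangoldt n * real n powr (- \<sigma>) \<le> real n powr ?e / ?e * real n powr (- \<sigma>)"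
      by (intro mult_right_mono) auto
    also have "\<dots> = real n powr (?e - \<sigma>) / ?e" by (simp add: powr_add[symmetric])
    finally show "norm (norm (mangoldt n :: complex) * real n powr (- \<sigma>)) \<le> real n powr (?e - \<sigma>) / ?e"
      by (simp add: mangoldt_nonneg)
  qed
qed

text \<open>The only arithmetic input is that the von Mangoldt function summed over the divisors of n is ln n. Stating the
logarithmic derivative without a division avoids the Euler product and any prior knowledge that
zeta has no zeros in Re s > 1.\<close>
lemma deriv_zeta_series:
  assumes s: "Re s > 1"
  shows "(zeta_series has_field_derivative - (mangoldt_series s * zeta_series s)) (at s)"
proof -
  obtain d where d: "(\<lambda>n. - of_real (ln (real n)) * 1 * of_nat n powr (- s)) sums d"
      "(zeta_series has_field_derivative d) (at s)"
    using has_field_derivative_dirichlet_series[OF summable_zeta s] unfolding zeta_series_def by blast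
  let ?a = "\<lambda>n. mangoldt n * of_nat n powr (- s)" and ?b = "\<lambda>n. 1 * of_nat n powr (- s)"
  have "(\<lambda>n. if n = 0 then 0 else \<Sum>d | d dvd n. ?a d * ?b (n div d)) sums (suminf ?a * suminf ?b)"
    by (intro sums_dirichlet_product dirichlet_series_abs_summable summable_zeta summable_mangoldt s) auto
  also have "(\<lambda>n. if n = 0 then 0 else \<Sum>d | d dvd n. ?a d * ?b (n div d)) = 
      (\<lambda>n. of_real (ln (real n)) * of_nat n powr (- s))"
  proof
    fix n :: nat
    show "(if n = 0 then 0 else \<Sum>d | d dvd n. ?a d * ?b (n div d)) = of_real (ln (real n)) * of_nat n powr (- s)"
    proof (cases "n = 0")
      case False
      have "?a d * ?b (n div d) = mangoldt d * of_nat n powr (- s)" if dv: "d dvd n" for d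
      proof -
        obtain m where m: "n = d * m" using dv by (rule dvdE)
        have "of_nat n powr (- s) = of_nat d powr (- s) * (of_nat m powr (- s) :: complex)"
          using powr_times_real[of "of_nat d" "of_nat m" "- s"] by (simp add: m)
        then show ?thesis using m False by simp
      qed
      then have "(\<Sum>d | d dvd n. ?a d * ?b (n div d)) = (\<Sum>d | d dvd n. mangoldt d) * of_nat n powr (- s)"
        unfolding sum_distrib_right by (intro sum.cong refl) auto
      then show ?thesis using False mangoldt_sum[of n, where ?'a = complex] by simp
    qed simp
  qed
  finally have "(\<lambda>n. - (of_real (ln (real n)) * of_nat n powr (- s))) sums - (suminf ?a * suminf ?b)"
    by (rule sums_minus)
  then have "d = - (mangoldt_series s * zeta_series s)"
    using sums_unique2[OF d(1)] by (simp add: mangoldt_series_def zeta_series_def dirichlet_series_def)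
  then show ?thesis using d(2) by simp
qed

section \<open>Continuation of zeta past the line Re s = 1\<close>

text \<open>The terms of a series for (s - 1) zeta(s) - 1. Subtracting n powr (1 - s) - (n + 1) powr (1 - s),
whose sum over n is 1, leaves terms that are small enough to converge for Re s > 0; multiplying by
s - 1 first makes all of them entire.\<close>
definition zeta_pole_term :: "nat \<Rightarrow> complex \<Rightarrow> complex" where
  "zeta_pole_term n s = (s - 1) * of_nat (Suc n) powr (- s)
     - (of_nat (Suc n) powr (1 - s) - of_nat (Suc (Suc n)) powr (1 - s))"

text \<open>This is (s - 1) zeta(s), continued to Re s > 0.\<close>
definition zeta_pole :: "complex \<Rightarrow> complex" where
  "zeta_pole s = 1 + (\<Sum>n. zeta_pole_term n s)"

lemma has_field_derivative_powr_base:
  "Re z > 0 \<Longrightarrow> ((\<lambda>z. z powr s) has_field_derivative s * z powr (s - 1)) (at z within S)"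
  using has_field_derivative_powr[of z s, THEN has_field_derivative_at_within]
  by (auto simp: complex_nonpos_Reals_iff)

lemma segment_real_point:
  assumes "z \<in> closed_segment (of_real a) (of_real b :: complex)" "a \<le> b"
  obtains t where "z = of_real t" "a \<le> t" "t \<le> b"
proof -
  obtain u where u: "0 \<le> u" "u \<le> 1" "z = of_real ((1 - u) * a + u * b)"
    using assms by (auto simp: closed_segment_def scaleR_conv_of_real)
  have "(1 - u) * a + u * a \<le> (1 - u) * a + u * b" "(1 - u) * a + u * b \<le> (1 - u) * b + u * b"
    using u assms by (auto intro!: mult_left_mono add_mono)
  then show ?thesis using that[OF u(3)] by (simp add: algebra_simps)
qed

text \<open>The term is an integral of (1 - s) (t powr (- s) - a powr (- s)) over [a, a + 1] with a = n + 1, and the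
difference inside is again bounded by the mean value theorem.\<close>
lemma norm_zeta_pole_term_le:
  assumes s: "Re s \<ge> 0"
  shows "norm (zeta_pole_term n s) \<le> norm (s - 1) * norm s * real (Suc n) powr (- Re s - 1)"
proof -
  define a where "a = real (Suc n)"
  have a: "a \<ge> 1" by (simp add: a_def)
  let ?N = "of_real a :: complex"
  let ?S = "closed_segment ?N (of_real (a + 1))"
  define B where "B = norm s * a powr (- Re s - 1)"
  have norm_le: "norm (of_real t powr w :: complex) \<le> a powr Re w" if "t \<ge> a" "Re w \<le> 0" for t w
    using that a by (simp add: norm_powr_real_powr powr_mono2')
  have dist1: "norm (of_real t - ?N) \<le> 1" if "a \<le> t" "t \<le> a + 1" for t
    using that by (simp flip: of_real_diff)
  \<comment> \<open>The complex mean value inequality is applied on a segment of the real axis.\<close>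
  have seg: "\<exists>t. z = of_real t \<and> a \<le> t \<and> t \<le> a + 1" if "z \<in> ?S" for z
    using that by (rule segment_real_point) auto
  have inner: "norm (z powr (- s) - ?N powr (- s)) \<le> B" if z: "z \<in> ?S" for z
  proof -
    obtain t where t: "z = of_real t" "a \<le> t" "t \<le> a + 1" using seg[OF z] by auto
    have "norm (z powr (- s) - ?N powr (- s)) \<le> B * norm (z - ?N)"
    proof (rule field_differentiable_bound[where S = ?S])
      fix x assume x: "x \<in> ?S"
      then obtain u where u: "x = of_real u" "a \<le> u" "u \<le> a + 1" using seg[OF x] by auto
      show "((\<lambda>z. z powr (- s)) has_field_derivative - s * x powr (- s - 1)) (at x within ?S)"
        by (rule has_field_derivative_powr_base) (use u a in auto)
      show "norm (- s * x powr (- s - 1)) \<le> B"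
        unfolding B_def norm_mult u using norm_le[of u "- s - 1"] u s by (intro mult_mono) auto
    qed (use z in auto)
    also have "\<dots> \<le> B * 1" unfolding t(1) by (intro mult_left_mono dist1 t) (auto simp: B_def)
    finally show ?thesis by simp
  qed
  let ?h = "\<lambda>z. z powr (1 - s) - (1 - s) * ?N powr (- s) * z"
  have "norm (?h (of_real (a + 1)) - ?h ?N) \<le> norm (1 - s) * B * norm (of_real (a + 1) - ?N)"
  proof (rule field_differentiable_bound[where S = ?S])
    fix x assume x: "x \<in> ?S"
    then obtain u where u: "x = of_real u" "a \<le> u" "u \<le> a + 1" using seg[OF x] by auto
    show "(?h has_field_derivative (1 - s) * (x powr (- s) - ?N powr (- s))) (at x within ?S)"
      using has_field_derivative_powr_base[of x "1 - s" ?S] u a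
      by (auto intro!: derivative_eq_intros simp: algebra_simps)
    show "norm ((1 - s) * (x powr (- s) - ?N powr (- s))) \<le> norm (1 - s) * B"
      unfolding norm_mult by (intro mult_left_mono inner x) auto
  qed auto
  also have "?h (of_real (a + 1)) - ?h ?N = zeta_pole_term n s"
    by (simp add: zeta_pole_term_def a_def algebra_simps)
  also have "norm (1 - s) * B * norm (of_real (a + 1) - ?N) = norm (s - 1) * norm s * real (Suc n) powr (- Re s - 1)"
    by (simp add: B_def a_def norm_minus_commute)
  finally show ?thesis .
qed

lemma zeta_pole_term_deriv: "\<exists>d. (zeta_pole_term n has_field_derivative d) (at s)"
proof -
  have "zeta_pole_term n holomorphic_on UNIV"
    unfolding zeta_pole_term_def by (intro holomorphic_intros)
  then show ?thesis
    by (auto simp: holomorphic_on_def field_differentiable_def)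
qed

lemma zeta_pole_properties:
  shows zeta_pole_holomorphic: "zeta_pole holomorphic_on {s. Re s > 0}"
    and zeta_pole_sums: "Re s > 0 \<Longrightarrow> (\<lambda>n. zeta_pole_term n s) sums (zeta_pole s - 1)"
proof -
  let ?S = "{s. Re s > 0}"
  obtain f' where der: "\<And>n x. (zeta_pole_term n has_field_derivative f' n x) (at x)"
    using zeta_pole_term_deriv by metis
  have op: "open ?S" by (rule open_halfspace_Re_gt)
  have ex: "\<exists>d h. 0 < d \<and> summable h \<and> range h \<subseteq> \<real>\<^sub>\<ge>\<^sub>0 \<and>
      (\<forall>\<^sub>F n in sequentially. \<forall>y\<in>ball x d \<inter> ?S. norm (zeta_pole_term n y) \<le> norm (h n :: complex))" 
    if "x \<in> ?S" for x
  proof -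
    define d where "d = Re x / 2"
    have d: "d > 0" "Re x - d > 0" using that by (auto simp: d_def field_simps)
    define c where "c = norm x + d + 1"
    define h where "h = (\<lambda>n. of_real (c * c * real (Suc n) powr (- (Re x - d) - 1)) :: complex)"
    have c: "c > 0" using d by (simp add: c_def add_nonneg_pos)
    have "norm (zeta_pole_term n y) \<le> norm (h n)" if "y \<in> ball x d" for n y
    proof -
      have "\<bar>Re (x - y)\<bar> < d" using that abs_Re_le_cmod[of "x - y"] by (simp add: dist_norm)
      then have y: "Re y \<ge> Re x - d" by auto
      have n1: "norm y \<le> norm x + d" 
        using that norm_triangle_ineq2[of y x] by (simp add: dist_norm norm_minus_commute)
      then have "norm (y - 1) \<le> c" "norm y \<le> c"
        using norm_triangle_ineq4[of y 1] by (auto simp: c_def)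
      have "norm (zeta_pole_term n y) \<le> norm (y - 1) * norm y * real (Suc n) powr (- Re y - 1)"
        using y d by (intro norm_zeta_pole_term_le) auto
      also have "\<dots> \<le> c * c * real (Suc n) powr (- (Re x - d) - 1)"
        using \<open>norm (y - 1) \<le> c\<close> \<open>norm y \<le> c\<close> c y by (intro mult_mono powr_mono) auto
      finally show ?thesis unfolding h_def norm_of_real by simp
    qed
    then have "\<forall>\<^sub>F n in sequentially. \<forall>y\<in>ball x d \<inter> ?S. norm (zeta_pole_term n y) \<le> norm (h n)"
      by (intro always_eventually allI ballI) auto
    moreover have "summable h" unfolding h_def
    proof (intro summable_of_real summable_mult)
      have "summable (\<lambda>n. real n powr (- (Re x - d) - 1))"
        using d by (simp add: summable_real_powr_iff)
      then show "summable (\<lambda>n. real (Suc n) powr (- (Re x - d) - 1))"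
        by (subst summable_Suc_iff)
    qed
    moreover have "range h \<subseteq> \<real>\<^sub>\<ge>\<^sub>0" using c by (auto simp: h_def)
    ultimately show ?thesis using d by blast
  qed
  obtain g g' where g: "\<And>x. x \<in> ?S \<Longrightarrow> (\<lambda>n. zeta_pole_term n x) sums g x" 
     "\<And>x. x \<in> ?S \<Longrightarrow> (g has_field_derivative g' x) (at x)"
    using series_and_derivative_comparison_complex[OF op der ex] by blast
  have eq: "zeta_pole x = 1 + g x" if "x \<in> ?S" for x
    using sums_unique[OF g(1)[OF that]] by (simp add: zeta_pole_def)
  show "Re s > 0 \<Longrightarrow> (\<lambda>n. zeta_pole_term n s) sums (zeta_pole s - 1)"
    using g(1)[of s] eq[of s] by simp
  have "g holomorphic_on ?S"
    using g(2) by (auto simp: holomorphic_on_open[OF op])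
  then have "(\<lambda>s. 1 + g s) holomorphic_on ?S" by (intro holomorphic_intros)
  then show "zeta_pole holomorphic_on ?S"
    by (rule holomorphic_transform) (simp add: eq)
qed

lemma zeta_pole_1 [simp]: "zeta_pole 1 = 1"
  by (simp add: zeta_pole_def zeta_pole_term_def del: of_nat_Suc)

lemma tendsto_nat_powr_0:
  assumes "Re s < 0"
  shows "(\<lambda>n. of_nat n powr s :: complex) \<longlonglongrightarrow> 0"
proof (rule tendsto_norm_zero_cancel)
  show "(\<lambda>n. norm (of_nat n powr s :: complex)) \<longlonglongrightarrow> 0"
    unfolding norm_nat_powr by (rule tendsto_neg_powr[OF assms filterlim_real_sequentially])
qed

lemma zeta_pole_eq:
  assumes s: "Re s > 1"
  shows "zeta_pole s = (s - 1) * zeta_series s"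
proof -
  have "(\<lambda>n. of_nat n powr (- s)) sums zeta_series s"
    using dirichlet_series_sums[OF summable_zeta s] by (simp add: zeta_series_def)
  then have "(\<lambda>n. of_nat (Suc n) powr (- s)) sums zeta_series s"
    by (subst sums_Suc_iff) simp
  then have 1: "(\<lambda>n. (s - 1) * of_nat (Suc n) powr (- s)) sums ((s - 1) * zeta_series s)"
    by (rule sums_mult)
  have "(\<lambda>n. of_nat n powr (1 - s) :: complex) \<longlonglongrightarrow> 0"
    using s by (intro tendsto_nat_powr_0) auto
  then have "(\<lambda>n. of_nat (Suc n) powr (1 - s) :: complex) \<longlonglongrightarrow> 0"
    by (rule LIMSEQ_Suc)
  from telescope_sums'[OF this]
  have 2: "(\<lambda>n. of_nat (Suc n) powr (1 - s) - of_nat (Suc (Suc n)) powr (1 - s)) sums (1 :: complex)"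
    by simp
  have "(\<lambda>n. zeta_pole_term n s) sums ((s - 1) * zeta_series s - 1)"
    unfolding zeta_pole_term_def by (rule sums_diff[OF 1 2])
  then have "zeta_pole s - 1 = (s - 1) * zeta_series s - 1"
    using zeta_pole_sums[of s] s sums_unique2 by force
  then show ?thesis by simp
qed

lemma deriv_zeta_pole:
  assumes s: "Re s > 1"
  shows "deriv zeta_pole s = zeta_pole s * (1 / (s - 1) - mangoldt_series s)"
proof (rule DERIV_imp_deriv)
  have s1: "s \<noteq> 1" using s by auto
  have "((\<lambda>s. (s - 1) * zeta_series s) has_field_derivative 
      (zeta_series s - (s - 1) * (mangoldt_series s * zeta_series s))) (at s)"
    using deriv_zeta_series[OF s] by (auto intro!: derivative_eq_intros)
  also have "zeta_series s - (s - 1) * (mangoldt_series s * zeta_series s) =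
      zeta_pole s * (1 / (s - 1) - mangoldt_series s)"
    unfolding zeta_pole_eq[OF s] using s1 by (simp add: field_simps)
  finally show "(zeta_pole has_field_derivative zeta_pole s * (1 / (s - 1) - mangoldt_series s)) (at s)"
    by (rule has_field_derivative_transform_within_open[where S = "{s. Re s > 1}"])
      (use s open_halfspace_Re_gt in \<open>auto simp: zeta_pole_eq\<close>)
qed

section \<open>Zeta does not vanish on Re s = 1\<close>

text \<open>Near s0 the function is (w - s0)^m times a function without zeros, so its logarithmic derivative has
residue m at s0; it is enough to approach s0 horizontally from the right.\<close>
lemma log_deriv_order:
  assumes f: "f holomorphic_on S" "open S" "connected S" "s0 \<in> S" "\<exists>w\<in>S. f w \<noteq> 0"
  obtains m :: nat where "m = 0 \<longleftrightarrow> f s0 \<noteq> 0"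
    "\<forall>\<^sub>F e in at_right 0. f (s0 + of_real e) \<noteq> 0"
    "((\<lambda>e. of_real e * (deriv f (s0 + of_real e) / f (s0 + of_real e))) \<longlongrightarrow> of_nat m) (at_right 0)"
proof -
  define g where "g = zor_poly f s0"
  define m where "m = nat (zorder f s0)"
  obtain r where r: "r > 0" "cball s0 r \<subseteq> S" "g holomorphic_on cball s0 r"
    "\<And>w. w \<in> cball s0 r \<Longrightarrow> f w = g w * (w - s0) ^ m \<and> g w \<noteq> 0"
    and ord: "if f s0 = 0 then zorder f s0 > 0 else zorder f s0 = 0"
    using zorder_exist_zero[OF f] unfolding g_def m_def by blast
  have g: "g holomorphic_on ball s0 r" using r(3) by (rule holomorphic_on_subset) auto
  have ev: "\<forall>\<^sub>F e in at_right 0. e < r \<and> 0 < e"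
    using r(1) by (auto simp: eventually_at_right_field)
  show ?thesis
  proof
    show "m = 0 \<longleftrightarrow> f s0 \<noteq> 0" using ord by (auto simp: m_def split: if_splits)
    show "\<forall>\<^sub>F e in at_right 0. f (s0 + of_real e) \<noteq> 0"
      using ev by eventually_elim (use r(4) in \<open>auto simp: dist_norm\<close>)
    have eq: "of_real e * (deriv f (s0 + of_real e) / f (s0 + of_real e)) =
        of_nat m + of_real e * (deriv g (s0 + of_real e) / g (s0 + of_real e))" if e: "e < r" "0 < e" for e
    proof -
      let ?w = "s0 + of_real e"
      have w: "?w \<in> ball s0 r" using e by (simp add: dist_norm)
      have "(g has_field_derivative deriv g ?w) (at ?w)"
        using holomorphic_derivI[OF g _ w] by simp
      then have "((\<lambda>w. g w * (w - s0) ^ m) has_field_derivative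
          (deriv g ?w * of_real e ^ m + of_nat m * of_real e ^ (m - 1) * g ?w)) (at ?w)"
        by (auto intro!: derivative_eq_intros)
      then have "(f has_field_derivative
          (deriv g ?w * of_real e ^ m + of_nat m * of_real e ^ (m - 1) * g ?w)) (at ?w)"
        by (rule has_field_derivative_transform_within_open[where S = "ball s0 r"]) (use w r(4) in auto)
      then have "deriv f ?w = deriv g ?w * of_real e ^ m + of_nat m * of_real e ^ (m - 1) * g ?w"
        by (rule DERIV_imp_deriv)
      moreover have "f ?w = g ?w * of_real e ^ m" "g ?w \<noteq> 0" using r(4)[of ?w] w by auto
      moreover have "of_real e * (of_nat m * of_real e ^ (m - 1)) = of_nat m * (of_real e ^ m :: complex)"
        by (cases m) auto
      ultimately show ?thesis using e by (simp add: field_simps)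
    qed
    have s0: "s0 \<in> ball s0 r" using r by simp
    have "isCont g s0" "isCont (deriv g) s0"
      using g holomorphic_deriv[OF g] s0 
      by (auto dest!: holomorphic_on_imp_continuous_on simp: continuous_on_eq_continuous_at)
    moreover have "((\<lambda>e. s0 + of_real e) \<longlongrightarrow> s0) (at_right 0)"
      by (auto intro!: tendsto_eq_intros)
    ultimately have "((\<lambda>e. g (s0 + of_real e)) \<longlongrightarrow> g s0) (at_right 0)"
      "((\<lambda>e. deriv g (s0 + of_real e)) \<longlongrightarrow> deriv g s0) (at_right 0)"
      by (auto intro: isCont_tendsto_compose)
    then have "((\<lambda>e. of_nat m + of_real e * (deriv g (s0 + of_real e) / g (s0 + of_real e))) \<longlongrightarrow> 
         of_nat m + of_real 0 * (deriv g s0 / g s0)) (at_right 0)"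
      using r(4)[of s0] r(1) by (intro tendsto_intros) auto
    then have "((\<lambda>e. of_nat m + of_real e * (deriv g (s0 + of_real e) / g (s0 + of_real e))) \<longlongrightarrow> of_nat m) (at_right 0)"
      by simp
    then show "((\<lambda>e. of_real e * (deriv f (s0 + of_real e) / f (s0 + of_real e))) \<longlongrightarrow> of_nat m) (at_right 0)"
      by (rule Lim_transform_eventually) (use ev eq in \<open>auto elim!: eventually_mono\<close>)
  qed
qed

text \<open>From zeta_pole' = zeta_pole (1/(s - 1) - D), where D is the Dirichlet series of the von Mangoldt
function: the simple pole of zeta contributes 1 at s0 = 1, a zero of order m contributes - m.\<close>
lemma mangoldt_series_residue:
  assumes s: "Re s0 \<ge> 1"
  obtains m :: nat where "m = 0 \<longleftrightarrow> zeta_pole s0 \<noteq> 0"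
    "((\<lambda>e. of_real e * mangoldt_series (s0 + of_real e)) \<longlongrightarrow> (if s0 = 1 then 1 else 0) - of_nat m) (at_right 0)"
proof -
  have op: "open {s. Re s > 0}" "connected {s. Re s > 0}"
    by (auto intro!: convex_connected simp: convex_halfspace_Re_gt open_halfspace_Re_gt)
  have ex: "\<exists>w\<in>{s. Re s > 0}. zeta_pole w \<noteq> 0" by (rule bexI[of _ 1]) auto
  have s0: "s0 \<in> {s. Re s > 0}" using s by simp
  obtain m :: nat where m: "m = 0 \<longleftrightarrow> zeta_pole s0 \<noteq> 0"
    "\<forall>\<^sub>F e in at_right 0. zeta_pole (s0 + of_real e) \<noteq> 0"
    "((\<lambda>e. of_real e * (deriv zeta_pole (s0 + of_real e) / zeta_pole (s0 + of_real e))) \<longlongrightarrow> of_nat m) (at_right 0)"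
    by (rule log_deriv_order[OF zeta_pole_holomorphic op s0 ex])
  have lim1: "((\<lambda>e. of_real e / (s0 + of_real e - 1)) \<longlongrightarrow> (if s0 = 1 then 1 else 0)) (at_right 0)"
  proof (cases "s0 = 1")
    case True
    have "\<forall>\<^sub>F e in at_right (0::real). 1 = of_real e / (s0 + of_real e - 1 :: complex)"
      using eventually_at_right_less[of "0::real"] by eventually_elim (use True in auto)
    then have "((\<lambda>e. of_real e / (s0 + of_real e - 1)) \<longlongrightarrow> 1) (at_right (0::real))"
      by (rule Lim_transform_eventually[OF tendsto_const])
    then show ?thesis using True by simp
  next
    case False
    have "((\<lambda>e. of_real e / (s0 + of_real e - 1)) \<longlongrightarrow> of_real 0 / (s0 + of_real 0 - 1)) (at_right 0)"
      using False by (intro tendsto_intros) auto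
    then show ?thesis using False by simp
  qed
  have "((\<lambda>e. of_real e / (s0 + of_real e - 1) - of_real e * (deriv zeta_pole (s0 + of_real e) / zeta_pole (s0 + of_real e)))
     \<longlongrightarrow> (if s0 = 1 then 1 else 0) - of_nat m) (at_right 0)"
    by (intro tendsto_diff lim1 m(3))
  moreover have "\<forall>\<^sub>F e in at_right 0. 
     of_real e / (s0 + of_real e - 1) - of_real e * (deriv zeta_pole (s0 + of_real e) / zeta_pole (s0 + of_real e))
     = of_real e * mangoldt_series (s0 + of_real e)"
    using eventually_at_right_less[of "0::real"] m(2)
  proof eventually_elim
    case (elim e)
    then have "deriv zeta_pole (s0 + of_real e) / zeta_pole (s0 + of_real e)
      = 1 / (s0 + of_real e - 1) - mangoldt_series (s0 + of_real e)"
      using s by (subst deriv_zeta_pole) auto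
    then show ?case by (simp add: right_diff_distrib)
  qed
  ultimately have "((\<lambda>e. of_real e * mangoldt_series (s0 + of_real e)) \<longlongrightarrow> (if s0 = 1 then 1 else 0) - of_nat m) (at_right 0)"
    by (rule Lim_transform_eventually)
  from that[OF m(1) this] show ?thesis .
qed

text \<open>At such a point the series is continuous, so its residue is 0 and the order of vanishing is too.\<close>
lemma zeta_pole_nonzero_right:
  assumes s: "Re s0 > 1"
  shows "zeta_pole s0 \<noteq> 0"
proof -
  obtain m :: nat where m: "m = 0 \<longleftrightarrow> zeta_pole s0 \<noteq> 0"
    "((\<lambda>e. of_real e * mangoldt_series (s0 + of_real e)) \<longlongrightarrow> (if s0 = 1 then 1 else 0) - of_nat m) (at_right 0)"
    by (rule mangoldt_series_residue[of s0]) (use s in auto)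
  have "isCont mangoldt_series s0"
    using has_field_derivative_dirichlet_series[OF summable_mangoldt s] 
    unfolding mangoldt_series_def by (auto intro: DERIV_isCont)
  moreover have "((\<lambda>e. s0 + of_real e) \<longlongrightarrow> s0) (at_right 0)"
    by (auto intro!: tendsto_eq_intros)
  ultimately have "((\<lambda>e. mangoldt_series (s0 + of_real e)) \<longlongrightarrow> mangoldt_series s0) (at_right 0)"
    by (rule isCont_tendsto_compose)
  then have "((\<lambda>e. of_real e * mangoldt_series (s0 + of_real e)) \<longlongrightarrow> of_real 0 * mangoldt_series s0) (at_right 0)"
    by (intro tendsto_intros)
  from tendsto_unique[OF _ this m(2)] have "of_nat m = (0 :: complex)"
    using s by (auto split: if_splits)
  then show ?thesis using m(1) by simp
qed

text \<open>Termwise this is the inequality 3 + 4 cos u + cos (2 u) = 2 (1 + cos u)^2 \<ge> 0.\<close>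
lemma mangoldt_series_3_4_1:
  fixes \<sigma> t :: real
  assumes "\<sigma> > 1"
  shows "3 * Re (mangoldt_series (of_real \<sigma>)) + 4 * Re (mangoldt_series (of_real \<sigma> + \<i> * of_real t))
     + Re (mangoldt_series (of_real \<sigma> + \<i> * of_real (2 * t))) \<ge> 0"
proof -
  have sm: "(\<lambda>n. mangoldt n * (real n powr (- \<sigma>) * cos (u * ln (real n)))) sums
      Re (mangoldt_series (of_real \<sigma> + \<i> * of_real u))" for u
  proof -
    have "(\<lambda>n. Re (mangoldt n * of_nat n powr (- (of_real \<sigma> + \<i> * of_real u)))) sums 
      Re (mangoldt_series (of_real \<sigma> + \<i> * of_real u))"
      unfolding mangoldt_series_def
      by (intro sums_Re dirichlet_series_sums summable_mangoldt) (use assms in auto)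
    also have "(\<lambda>n. Re (mangoldt n * of_nat n powr (- (of_real \<sigma> + \<i> * of_real u)))) =
       (\<lambda>n. mangoldt n * (real n powr (- \<sigma>) * cos (u * ln (real n))))"
    proof
      fix n :: nat
      show "Re (mangoldt n * of_nat n powr (- (of_real \<sigma> + \<i> * of_real u))) =
        mangoldt n * (real n powr (- \<sigma>) * cos (u * ln (real n)))"
      proof (cases "n = 0")
        case False
        then have "of_nat n powr (- (of_real \<sigma> + \<i> * of_real u)) = 
           exp (Complex (- \<sigma> * ln n) (- (u * ln n)))"
          by (simp add: powr_def Ln_of_nat complex_eq_iff Re_exp Im_exp)
        then have "Re (of_nat n powr (- (of_real \<sigma> + \<i> * of_real u))) = real n powr (- \<sigma>) * cos (u * ln (real n))"
          using False by (simp add: Re_exp powr_def)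
        then show ?thesis by simp
      qed simp
    qed
    finally show ?thesis .
  qed
  have "(\<lambda>n. 3 * (mangoldt n * (real n powr (- \<sigma>) * cos (0 * ln (real n)))) +
     4 * (mangoldt n * (real n powr (- \<sigma>) * cos (t * ln (real n)))) +
     mangoldt n * (real n powr (- \<sigma>) * cos (2 * t * ln (real n)))) sums
     (3 * Re (mangoldt_series (of_real \<sigma> + \<i> * of_real 0)) + 4 * Re (mangoldt_series (of_real \<sigma> + \<i> * of_real t))
     + Re (mangoldt_series (of_real \<sigma> + \<i> * of_real (2 * t))))"
    by (intro sums_add sums_mult sm)
  moreover have "0 \<le> 3 * (mangoldt n * (real n powr (- \<sigma>) * cos (0 * ln (real n)))) +
     4 * (mangoldt n * (real n powr (- \<sigma>) * cos (t * ln (real n)))) +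
     mangoldt n * (real n powr (- \<sigma>) * cos (2 * t * ln (real n)))" for n
  proof -
    have dbl: "cos (2 * t * ln (real n)) = 2 * (cos (t * ln (real n)))\<^sup>2 - 1"
      using cos_double_cos[of "t * ln (real n)"] by (simp add: mult.assoc)
    have alg: "3 * (M * (P * 1)) + 4 * (M * (P * c)) + M * (P * (2 * c\<^sup>2 - 1)) = M * P * (2 * (1 + c)\<^sup>2)"
      for M P c :: real by (simp add: power2_eq_square algebra_simps)
    have "3 * (mangoldt n * (real n powr (- \<sigma>) * cos (0 * ln (real n)))) +
     4 * (mangoldt n * (real n powr (- \<sigma>) * cos (t * ln (real n)))) +
     mangoldt n * (real n powr (- \<sigma>) * cos (2 * t * ln (real n)))
      = mangoldt n * real n powr (- \<sigma>) * (2 * (1 + cos (t * ln (real n)))\<^sup>2)"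
      unfolding dbl alg[symmetric] by simp
    also have "\<dots> \<ge> 0" by (intro mult_nonneg_nonneg mangoldt_nonneg) auto
    finally show ?thesis .
  qed
  ultimately have "0 \<le> 3 * Re (mangoldt_series (of_real \<sigma> + \<i> * of_real 0)) + 4 * Re (mangoldt_series (of_real \<sigma> + \<i> * of_real t))
     + Re (mangoldt_series (of_real \<sigma> + \<i> * of_real (2 * t)))"
    by (rule sums_le[OF _ sums_zero, rotated])
  then show ?thesis by simp
qed

text \<open>If zeta vanished at 1 + it to order m1 and at 1 + 2it to order m2, then multiplying the 3-4-1 inequality by
\<sigma> - 1 and letting \<sigma> tend to 1 would give 3 - 4 m1 - m2 \<ge> 0, which forces m1 = 0.\<close>
theorem zeta_pole_nonzero:
  assumes "Re s \<ge> 1"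
  shows "zeta_pole s \<noteq> 0"
proof (cases "s = 1 \<or> Re s > 1")
  case True
  then show ?thesis using zeta_pole_nonzero_right by auto
next
  case False
  define t where "t = Im s"
  have s: "s = 1 + \<i> * of_real t" and t: "t \<noteq> 0"
    using False assms by (auto simp: t_def complex_eq_iff)
  define res where "res = (\<lambda>u m. ((\<lambda>e. of_real e * mangoldt_series (1 + \<i> * of_real u + of_real e))
       \<longlongrightarrow> (if u = 0 then 1 else 0) - of_nat m) (at_right (0::real)))"
  have ex: "\<exists>m::nat. (m = 0 \<longleftrightarrow> zeta_pole (1 + \<i> * of_real u) \<noteq> 0) \<and> res u m" for u
  proof -
    obtain m :: nat where m: "m = 0 \<longleftrightarrow> zeta_pole (1 + \<i> * of_real u) \<noteq> 0"
      "((\<lambda>e. of_real e * mangoldt_series (1 + \<i> * of_real u + of_real e)) \<longlongrightarrow> 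
       (if 1 + \<i> * of_real u = 1 then 1 else 0) - of_nat m) (at_right 0)"
      by (rule mangoldt_series_residue[of "1 + \<i> * of_real u"]) auto
    then have "res u m" by (simp add: res_def)
    with m(1) show ?thesis by (intro exI[of _ m] conjI)
  qed
  obtain m0 :: nat where m0: "m0 = 0 \<longleftrightarrow> zeta_pole (1 + \<i> * of_real 0) \<noteq> 0" "res 0 m0"
    using ex[of 0] by (elim exE conjE)
  obtain m1 :: nat where m1: "m1 = 0 \<longleftrightarrow> zeta_pole (1 + \<i> * of_real t) \<noteq> 0" "res t m1"
    using ex[of t] by (elim exE conjE)
  obtain m2 :: nat where m2: "res (2 * t) m2"
    using ex[of "2 * t"] by (elim exE conjE)
  have re: "((\<lambda>e. e * Re (mangoldt_series (of_real (1 + e) + \<i> * of_real u))) \<longlongrightarrow> (if u = 0 then 1 else 0) - real k) (at_right 0)"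
    if "res u k" for u k
  proof -
    have "((\<lambda>e. Re (of_real e * mangoldt_series (1 + \<i> * of_real u + of_real e)))
       \<longlongrightarrow> Re ((if u = 0 then 1 else 0) - of_nat k)) (at_right (0::real))"
      using that unfolding res_def by (rule tendsto_Re)
    then show ?thesis by (cases "u = 0") (simp_all add: add_ac)
  qed
  have "((\<lambda>e. 3 * (e * Re (mangoldt_series (of_real (1 + e) + \<i> * of_real 0))) +
      4 * (e * Re (mangoldt_series (of_real (1 + e) + \<i> * of_real t))) +
      e * Re (mangoldt_series (of_real (1 + e) + \<i> * of_real (2 * t)))) \<longlongrightarrow>
      3 * ((if (0::real) = 0 then 1 else 0) - real m0) + 4 * ((if t = 0 then 1 else 0) - real m1) 
       + ((if 2 * t = 0 then 1 else 0) - real m2)) (at_right 0)"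
    by (intro tendsto_add tendsto_mult[OF tendsto_const] re m0 m1 m2)
  moreover have "\<forall>\<^sub>F e in at_right (0::real). 0 \<le> 3 * (e * Re (mangoldt_series (of_real (1 + e) + \<i> * of_real 0))) +
      4 * (e * Re (mangoldt_series (of_real (1 + e) + \<i> * of_real t))) +
      e * Re (mangoldt_series (of_real (1 + e) + \<i> * of_real (2 * t)))"
    using eventually_at_right_less[of "0::real"]
  proof eventually_elim
    case (elim e)
    have "0 \<le> e * (3 * Re (mangoldt_series (of_real (1 + e))) + 4 * Re (mangoldt_series (of_real (1 + e) + \<i> * of_real t))
     + Re (mangoldt_series (of_real (1 + e) + \<i> * of_real (2 * t))))"
      using elim by (intro mult_nonneg_nonneg mangoldt_series_3_4_1) auto
    then show ?case by (simp add: algebra_simps)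
  qed
  ultimately have "0 \<le> 3 * ((if (0::real) = 0 then 1 else 0) - real m0) + 4 * ((if t = 0 then 1 else 0) - real m1) 
       + ((if 2 * t = 0 then 1 else 0) - real m2)"
    by (intro tendsto_lowerbound) auto
  moreover have "m0 = 0" using m0(1) by simp
  ultimately have "m1 = 0" using t by (cases m1) auto
  then show ?thesis using m1 s by simp
qed

section \<open>Chebyshev's function psi\<close>

definition chebyshev_psi :: "nat \<Rightarrow> real" where
  "chebyshev_psi n = (\<Sum>d=1..n. mangoldt d)"

lemma chebyshev_psi_0 [simp]: "chebyshev_psi 0 = 0"
  by (simp add: chebyshev_psi_def)

lemma chebyshev_psi_Suc: "chebyshev_psi (Suc n) = chebyshev_psi n + mangoldt (Suc n)"
  by (simp add: chebyshev_psi_def)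

lemma chebyshev_psi_mono: "m \<le> n \<Longrightarrow> chebyshev_psi m \<le> chebyshev_psi n"
  unfolding chebyshev_psi_def by (intro sum_mono2) (auto intro: mangoldt_nonneg)

lemma chebyshev_psi_nonneg: "chebyshev_psi n \<ge> 0"
  unfolding chebyshev_psi_def by (intro sum_nonneg mangoldt_nonneg)

text \<open>Legendre's formula: passing from n to n + 1 raises the quotient n div d by one exactly for the
divisors d of n + 1.\<close>
lemma ln_fact_eq_mangoldt_sum:
  "ln (fact n) = (\<Sum>d=1..n. mangoldt d * real (n div d))"
proof (induction n)
  case (Suc n)
  have "(\<Sum>d=1..Suc n. mangoldt d * real (Suc n div d)) =
      (\<Sum>d=1..Suc n. mangoldt d * real (n div d) + (if d dvd Suc n then mangoldt d else 0))"
    by (intro sum.cong refl) (auto simp: div_Suc dvd_eq_mod_eq_0 algebra_simps)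
  also have "\<dots> = ln (fact n) + (\<Sum>d=1..Suc n. if d dvd Suc n then mangoldt d else 0)"
    using Suc by (simp add: sum.distrib)
  also have "(\<Sum>d=1..Suc n. if d dvd Suc n then mangoldt d else 0) = (\<Sum>d | d dvd Suc n. mangoldt d :: real)"
    by (intro sum.mono_neutral_cong_right) (auto simp: Suc_le_eq dvd_imp_le intro!: Nat.gr0I dest: dvd_imp_le)
  also have "\<dots> = ln (real (Suc n))" using mangoldt_sum[of "Suc n", where ?'a = real] by simp
  also have "ln (fact n) + ln (real (Suc n)) = ln (fact (Suc n))"
    by (simp add: ln_mult add.commute del: of_nat_Suc)
  finally show ?case by simp
qed simp

text \<open>In ln (2n choose n), each d has the nonnegative integer coefficient 2n div d - 2 (n div d), and
this coefficient is 1 for n < d \<le> 2n.\<close>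
lemma chebyshev_psi_double: "chebyshev_psi (2 * n) - chebyshev_psi n \<le> 2 * real n * ln 2"
proof -
  have "chebyshev_psi (2 * n) - chebyshev_psi n = (\<Sum>d=n+1..2*n. mangoldt d)"
  proof -
    have "{1..2*n} = {1..n} \<union> {n+1..2*n}" by auto
    then show ?thesis unfolding chebyshev_psi_def by (simp add: sum.union_disjoint)
  qed
  also have "\<dots> = (\<Sum>d=n+1..2*n. mangoldt d * (real (2 * n div d) - 2 * real (n div d)))"
  proof (intro sum.cong refl)
    fix d assume d: "d \<in> {n+1..2*n}"
    then have "2 * n div d = 1" by (intro div_nat_eqI) auto
    then show "mangoldt d = mangoldt d * (real (2 * n div d) - 2 * real (n div d))" using d by simp
  qed
  also have "\<dots> \<le> (\<Sum>d=1..2*n. mangoldt d * (real (2 * n div d) - 2 * real (n div d)))"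
  proof (intro sum_mono2)
    fix d
    have "2 * (n div d) \<le> 2 * n div d"
      by (cases "d = 0") (auto simp: less_eq_div_iff_mult_less_eq)
    then have "real (2 * (n div d)) \<le> real (2 * n div d)" by (simp only: of_nat_le_iff)
    then have "2 * real (n div d) \<le> real (2 * n div d)" by simp
    then show "0 \<le> mangoldt d * (real (2 * n div d) - 2 * real (n div d))"
      by (intro mult_nonneg_nonneg mangoldt_nonneg) auto
  qed auto
  also have "\<dots> = (\<Sum>d=1..2*n. mangoldt d * real (2 * n div d)) - 2 * (\<Sum>d=1..2*n. mangoldt d * real (n div d))"
    by (simp add: sum_subtractf sum_distrib_left algebra_simps)
  also have "(\<Sum>d=1..2*n. mangoldt d * real (n div d)) = (\<Sum>d=1..n. mangoldt d * real (n div d))"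
    by (intro sum.mono_neutral_right) auto
  also have "(\<Sum>d=1..2*n. mangoldt d * real (2 * n div d)) - 2 * (\<Sum>d=1..n. mangoldt d * real (n div d))
     = ln (fact (2 * n) / (fact n * fact n))"
    by (simp only: ln_fact_eq_mangoldt_sum[symmetric]) (simp add: ln_div ln_mult)
  also have "fact (2 * n) / (fact n * fact n) = real ((2 * n) choose n)"
    by (simp add: binomial_fact)
  also have "ln (real ((2 * n) choose n)) \<le> ln (2 ^ (2 * n))"
  proof -
    have "real ((2 * n) choose n) \<le> real (2 ^ (2 * n))"
      using binomial_le_pow2[of "2 * n" n] by (simp only: of_nat_le_iff)
    then show ?thesis by (subst ln_le_cancel_iff) auto
  qed
  also have "\<dots> = 2 * real n * ln 2" by (simp add: ln_realpow)
  finally show ?thesis .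
qed

lemma chebyshev_psi_le: "chebyshev_psi n \<le> 4 * ln 2 * real n"
proof (induction n rule: less_induct)
  case (less n)
  show ?case
  proof (cases "n < 2")
    case True
    then have "n = 0 \<or> n = 1" by auto
    then show ?thesis by (auto simp: chebyshev_psi_def)
  next
    case False
    \<comment> \<open>For n \<ge> 2 this is at most 2 n / 3, so the bound 4 m ln 2 + 2 m ln 2 is at most 4 n ln 2.\<close>
    define m where "m = (n + 1) div 2"
    have m: "m < n" "n \<le> 2 * m" "3 * m \<le> 2 * n" using False by (auto simp: m_def)
    have "chebyshev_psi n \<le> chebyshev_psi (2 * m)" by (rule chebyshev_psi_mono[OF m(2)])
    also have "\<dots> \<le> chebyshev_psi m + 2 * real m * ln 2" using chebyshev_psi_double[of m] by simp
    also have "\<dots> \<le> 4 * ln 2 * real m + 2 * real m * ln 2" using less.IH[OF m(1)] by (simp add: mult_ac)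
    also have "\<dots> = 2 * ln 2 * (3 * real m)" by simp
    also have "\<dots> \<le> 2 * ln 2 * (2 * real n)" using m(3) by (intro mult_left_mono) auto
    finally show ?thesis by simp
  qed
qed

lemma chebyshev_psi_minus_le: "\<bar>chebyshev_psi n - real n\<bar> \<le> 3 * real n"
proof -
  have "4 * ln 2 * real n \<le> 4 * real n" using ln_2_less_1 by (intro mult_right_mono) auto
  then show ?thesis using chebyshev_psi_le[of n] chebyshev_psi_nonneg[of n] by linarith
qed

text \<open>Suppose f N \<ge> lam N with lam > 1. By monotonicity f m - m is at least (lam - mu) N for all m between
N and mu N, where mu = (1 + lam)/2, and the terms for these m sum to at least a positive constant
independent of N. This contradicts Cauchy's criterion for large N. The case lam < 1 is symmetric, with
m running from mu N up to N.\<close>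
lemma mono_ratio_tendsto_1:
  fixes f :: "nat \<Rightarrow> real"
  assumes mono: "\<And>m n. m \<le> n \<Longrightarrow> f m \<le> f n"
    and sum: "summable (\<lambda>n. (f n - real n) / (real n * (real n + 1)))"
  shows "(\<lambda>n. f n / real n) \<longlonglongrightarrow> 1"
proof -
  let ?c = "\<lambda>n. (f n - real n) / (real n * (real n + 1))"
  have cauchy: "\<exists>N. \<forall>m\<ge>N. \<forall>n. \<bar>sum ?c {m..<n}\<bar> < e" if "e > 0" for e
    using sum that unfolding summable_Cauchy real_norm_def by blast
  have upper: "\<forall>\<^sub>F n in sequentially. f n / real n < lam" if lam: "lam > 1" for lam
  proof -
    define mu where "mu = (1 + lam) / 2"
    have mu: "1 < mu" "mu < lam" using lam by (auto simp: mu_def)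
    define e where "e = (mu - 1) * (lam - mu) / (mu * (mu + 1))"
    have e: "e > 0" using mu by (auto simp: e_def)
    obtain N0 where N0: "\<And>m n. m \<ge> N0 \<Longrightarrow> \<bar>sum ?c {m..<n}\<bar> < e" using cauchy[OF e] by blast
    show ?thesis using eventually_ge_at_top[of "max N0 1"]
    proof eventually_elim
      case (elim N)
      then have N: "N \<ge> N0" "N \<ge> 1" by auto
      show ?case
      proof (rule ccontr)
        assume "\<not> f N / real N < lam"
        then have fN: "f N \<ge> lam * real N" using N by (simp add: field_simps)
        define M where "M = nat \<lfloor>mu * real N\<rfloor> + 1"
        have M1: "real M > mu * real N" unfolding M_def using mu N by linarith
        have trm: "(lam - mu) * real N / (mu * real N * (mu * real N + 1)) \<le> ?c m" if m: "m \<in> {N..<M}" for m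
        proof -
          have m_le: "real m \<le> mu * real N"
          proof -
            have "m \<le> nat \<lfloor>mu * real N\<rfloor>" using m by (auto simp: M_def)
            then show ?thesis using mu N by (simp add: le_nat_iff le_floor_iff)
          qed
          have "f m \<ge> lam * real N" using fN mono[of N m] m by simp
          then have "(lam - mu) * real N \<le> f m - real m" using m_le by (simp add: algebra_simps)
          moreover have "0 \<le> (lam - mu) * real N" using mu by simp
          ultimately have "(lam - mu) * real N \<le> f m - real m" "0 \<le> f m - real m" by linarith+
          then show ?thesis
            using m_le m mu N by (intro frac_le mult_mono) (auto intro!: mult_pos_pos)
        qed
        have "e \<le> (mu - 1) * real N * ((lam - mu) * real N / (mu * real N * (mu * real N + 1)))"
        proof -
          have "(mu - 1) * real N * ((lam - mu) * real N / (mu * real N * (mu * real N + 1))) =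
              (mu - 1) * (lam - mu) * real N / (mu * (mu * real N + 1))"
          proof -
            have "(lam - mu) * real N / (mu * real N * Y) = (lam - mu) / (mu * Y)" for Y
              using N mu by (cases "Y = 0") (auto simp: field_simps)
            then show ?thesis by (simp add: mult_ac)
          qed
          moreover have "(mu - 1) * (lam - mu) / (mu * (mu + 1)) = 
             (mu - 1) * (lam - mu) * real N / (mu * (mu * real N + real N))"
          proof -
            have "mu * (mu * real N + real N) = (mu * (mu + 1)) * real N" by (simp add: algebra_simps)
            show ?thesis unfolding \<open>mu * (mu * real N + real N) = (mu * (mu + 1)) * real N\<close> using N by simp
          qed
          moreover have "(mu - 1) * (lam - mu) * real N / (mu * (mu * real N + real N)) \<le>
            (mu - 1) * (lam - mu) * real N / (mu * (mu * real N + 1))"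
            using mu N by (intro divide_left_mono mult_left_mono) (auto intro!: mult_pos_pos add_pos_pos)
          ultimately show ?thesis by (simp add: e_def)
        qed
        also have "\<dots> \<le> real (card {N..<M}) * ((lam - mu) * real N / (mu * real N * (mu * real N + 1)))"
          using M1 mu N by (intro mult_right_mono) (auto simp: algebra_simps)
        also have "\<dots> \<le> sum ?c {N..<M}"
          by (rule sum_bounded_below) (rule trm)
        also have "\<dots> < e" using N0[OF N(1), of M] by linarith
        finally show False by simp
      qed
    qed
  qed
  have lower: "\<forall>\<^sub>F n in sequentially. f n / real n > lam" if lam: "lam < 1" "lam > 0" for lam
  proof -
    define mu where "mu = (1 + lam) / 2"
    have mu: "lam < mu" "mu < 1" "mu > 0" using lam by (auto simp: mu_def)
    define e where "e = (1 - mu) * (mu - lam) / 2"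
    have e: "e > 0" using mu by (auto simp: e_def)
    obtain N0 where N0: "\<And>m n. m \<ge> N0 \<Longrightarrow> \<bar>sum ?c {m..<n}\<bar> < e" using cauchy[OF e] by blast
    \<comment> \<open>The sum starts at mu N, which has to exceed N0.\<close>
    define N1 where "N1 = nat \<lceil>real (max N0 1) / mu\<rceil>"
    show ?thesis using eventually_ge_at_top[of "max N1 1"]
    proof eventually_elim
      case (elim N)
      then have "N \<ge> 1" "N \<ge> N1" by auto
      then have "real (max N0 1) / mu \<le> real N" unfolding N1_def by linarith
      then have N0_mu: "real (max N0 1) \<le> mu * real N" using mu by (simp add: field_simps)
      show ?case
      proof (rule ccontr)
        assume "\<not> lam < f N / real N"
        then have fN: "f N \<le> lam * real N" using \<open>N \<ge> 1\<close> by (simp add: field_simps)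
        define M where "M = nat \<lceil>mu * real N\<rceil>"
        have M: "real M \<ge> mu * real N" "real M < mu * real N + 1" 
        proof -
          have "0 < mu * real N" using mu \<open>N \<ge> 1\<close> by simp
          then show "real M \<ge> mu * real N" "real M < mu * real N + 1"
            unfolding M_def by linarith+
        qed
        have M0: "M \<ge> N0" "M \<ge> 1" using M(1) N0_mu by linarith+
        have M_le: "M \<le> Suc N" 
        proof -
          have "mu * real N \<le> 1 * real N" using mu by (intro mult_right_mono) auto
          then have "real M < real (Suc N)" using M(2) by simp
          then show ?thesis by simp
        qed
        have trm: "?c m \<le> - ((mu - lam) * real N / (real N * (real N + 1)))" if m: "m \<in> {M..<Suc N}" for m
        proof -
          have m2: "m \<ge> 1" "real m \<ge> mu * real N" "m \<le> N" using m M M0 by auto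
          have "f m \<le> lam * real N" using fN mono[of m N] m2 by simp
          then have "real m - f m \<ge> (mu - lam) * real N" using m2 by (simp add: algebra_simps)
          moreover have "0 \<le> (mu - lam) * real N" using mu by simp
          ultimately have "(mu - lam) * real N \<le> real m - f m" "0 \<le> real m - f m" by linarith+
          then have "(mu - lam) * real N / (real N * (real N + 1)) \<le> (real m - f m) / (real m * (real m + 1))"
            using m2 mu by (intro frac_le mult_mono) (auto intro!: mult_pos_pos)
          moreover have "?c m = - ((real m - f m) / (real m * (real m + 1)))"
            by (subst minus_divide_left) simp
          ultimately show ?thesis by linarith
        qed
        have "sum ?c {M..<Suc N} \<le> real (card {M..<Suc N}) * (- ((mu - lam) * real N / (real N * (real N + 1))))"
          by (rule sum_bounded_above) (rule trm)
        also have "\<dots> \<le> ((1 - mu) * real N) * (- ((mu - lam) * real N / (real N * (real N + 1))))"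
        proof (rule mult_right_mono_neg)
          show "(1 - mu) * real N \<le> real (card {M..<Suc N})"
            using M M_le by (simp add: of_nat_diff algebra_simps)
          show "- ((mu - lam) * real N / (real N * (real N + 1))) \<le> 0" using mu by simp
        qed
        also have "\<dots> = - ((1 - mu) * (mu - lam) * (real N / (real N + 1)))"
        proof -
          have "(mu - lam) * real N / (real N * (real N + 1)) = (mu - lam) / (real N + 1)"
            using \<open>N \<ge> 1\<close> by simp
          then show ?thesis by (simp only:) (simp add: mult_ac)
        qed
        also have "\<dots> \<le> - ((1 - mu) * (mu - lam) * (1 / 2))"
        proof (intro le_imp_neg_le mult_left_mono)
          show "1 / 2 \<le> real N / (real N + 1)" using \<open>N \<ge> 1\<close> by (simp add: field_simps)
        qed (use mu in auto)
        also have "\<dots> = - e" by (simp add: e_def)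
        finally show False using N0[OF M0(1), of "Suc N"] by linarith
      qed
    qed
  qed
  show ?thesis
  proof (rule order_tendstoI)
    fix a :: real assume "a < 1"
    then have "max a (1/2) < 1" "max a (1/2) > 0" by auto
    from lower[OF this] show "\<forall>\<^sub>F n in sequentially. a < f n / real n"
      by eventually_elim simp
  qed (use upper in blast)
qed

section \<open>The asymptotics of psi\<close>

text \<open>The integral of t powr (- s - 1) over [n + 1, n + 2] in closed form; s = 0 is a removable singularity.\<close>
definition step_weight :: "nat \<Rightarrow> complex \<Rightarrow> complex" where
  "step_weight n s = (if s = 0 then of_real (ln (real (Suc (Suc n))) - ln (real (Suc n)))
     else (of_nat (Suc n) powr (- s) - of_nat (Suc (Suc n)) powr (- s)) / s)"

lemma step_weight_holomorphic: "step_weight n holomorphic_on UNIV"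
proof -
  let ?f = "\<lambda>s. of_nat (Suc n) powr (- s) - of_nat (Suc (Suc n)) powr (- s) :: complex"
  have nz: "of_nat (Suc k) \<noteq> (0::complex)" for k by (simp del: of_nat_Suc)
  have hol: "?f holomorphic_on UNIV" by (intro holomorphic_intros)
  have der: "((\<lambda>s. of_nat (Suc k) powr (- s) :: complex) has_field_derivative - of_real (ln (real (Suc k)))) (at 0)" for k
  proof -
    have "((\<lambda>s. of_nat (Suc k) powr (- s)) has_field_derivative
        Ln (of_nat (Suc k)) * of_nat (Suc k) powr (- 0) * (- 1 :: complex)) (at 0)"
      by (intro DERIV_chain2[OF has_field_derivative_powr_right]) (use nz in \<open>auto intro!: derivative_eq_intros simp del: of_nat_Suc\<close>)
    then show ?thesis using nz[of k] by (simp add: Ln_of_nat del: of_nat_Suc)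
  qed
  have "(?f has_field_derivative - of_real (ln (real (Suc n))) - - of_real (ln (real (Suc (Suc n))))) (at 0)"
    by (intro DERIV_diff der)
  then have d: "deriv ?f 0 = of_real (ln (real (Suc (Suc n))) - ln (real (Suc n)))"
    by (simp add: DERIV_imp_deriv del: of_nat_Suc)
  have "(\<lambda>s. if s = 0 then deriv ?f 0 else (?f s - ?f 0) / (s - 0)) holomorphic_on UNIV"
    by (rule pole_lemma[OF hol]) simp
  also have "(\<lambda>s. if s = 0 then deriv ?f 0 else (?f s - ?f 0) / (s - 0)) = step_weight n"
    unfolding d using nz by (auto simp: step_weight_def fun_eq_iff simp del: of_nat_Suc)
  finally show ?thesis .
qed

text \<open>The left side is b times an integral of t powr (- 2 - z) over [n + 1, n + 2], and |b| \<le> C t there; the right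
side is the integral of C t powr (- 1 - Re z). The point z = -1, where the primitive fails, is treated directly.\<close>
lemma norm_step_weight_le:
  assumes b: "\<bar>b\<bar> \<le> C * real (Suc n)" and x: "Re z \<noteq> 0"
  shows "norm (of_real b * step_weight n (1 + z)) \<le>
     C * (exp (- (ln (real (Suc n)) * Re z)) - exp (- (ln (real (Suc (Suc n))) * Re z))) / Re z"
proof (cases "z = -1")
  case True
  define a where "a = real (Suc n)"
  have a: "a \<ge> 1" by (simp add: a_def)
  have "norm (of_real b * step_weight n (1 + z)) = \<bar>b\<bar> * (ln (a + 1) - ln a)"
    using True a by (simp add: step_weight_def norm_mult a_def abs_if add_ac flip: of_real_diff)
  also have "ln (a + 1) - ln a = ln (1 + 1 / a)" 
  proof -
    have "1 + 1 / a = (a + 1) / a" using a by (simp add: field_simps)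
    then show ?thesis using a by (simp add: ln_div)
  qed
  also have "\<dots> \<le> 1 / a" using a by (intro ln_add_one_self_le_self) auto
  also have "\<bar>b\<bar> * (1 / a) \<le> C" 
  proof -
    have "\<bar>b\<bar> \<le> C * a" using b by (simp only: a_def)
    then show ?thesis using a by (simp add: field_simps)
  qed
  finally have "norm (of_real b * step_weight n (1 + z)) \<le> C" by (simp add: mult_left_mono)
  also have "C = C * (exp (- (ln (real (Suc n)) * Re z)) - exp (- (ln (real (Suc (Suc n))) * Re z))) / Re z"
    using True by simp
  finally show ?thesis .
next
  case False
  define a where "a = real (Suc n)"
  have a: "a \<ge> 1" by (simp add: a_def)
  define s where "s = 1 + z"
  have s: "s \<noteq> 0" "Re s = 1 + Re z" using False by (auto simp: s_def add_eq_0_iff)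
  have C: "C \<ge> 0" 
  proof -
    have "0 \<le> C * a" using b by (simp add: a_def)
    then show ?thesis using a by (simp add: zero_le_mult_iff)
  qed
  define f where "f = (\<lambda>t::real. - (of_real b * of_real t powr (- s) / s))"
  define \<phi> where "\<phi> = (\<lambda>t. - (C * t powr (- Re z) / Re z))"
  have fd: "(f has_vector_derivative (of_real b * of_real t powr (- s - 1))) (at t)" if "t > 0" for t
  proof -
    have "((\<lambda>w. - (of_real b * w powr (- s) / s)) has_field_derivative 
        (of_real b * of_real t powr (- s - 1))) (at (of_real t))"
      using that s has_field_derivative_powr_base[of "of_real t" "- s" UNIV]
      by (auto intro!: derivative_eq_intros)
    then show ?thesis unfolding f_def by (rule has_vector_derivative_real_field)
  qed
  have pd: "(\<phi> has_vector_derivative (C * t powr (- Re z - 1))) (at t)" if "t > 0" for t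
    unfolding \<phi>_def has_real_derivative_iff_has_vector_derivative[symmetric]
    using that x by (auto intro!: derivative_eq_intros)
  have "norm (f (a + 1) - f a) \<le> \<phi> (a + 1) - \<phi> a"
  proof (rule differentiable_bound_general)
    show "continuous_on {a..a + 1} f"
      by (intro continuous_at_imp_continuous_on ballI has_vector_derivative_continuous[OF fd])
        (use a in auto)
    show "continuous_on {a..a + 1} \<phi>"
      by (intro continuous_at_imp_continuous_on ballI has_vector_derivative_continuous[OF pd])
        (use a in auto)
    fix t assume t: "a < t" "t < a + 1"
    then have t0: "t > 0" using a by simp
    show "(f has_vector_derivative (of_real b * of_real t powr (- s - 1))) (at t)" by (rule fd[OF t0])
    show "(\<phi> has_vector_derivative (C * t powr (- Re z - 1))) (at t)" by (rule pd[OF t0])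
    have "norm (of_real b * of_real t powr (- s - 1)) = \<bar>b\<bar> * t powr (- Re z - 2)"
    proof -
      have "Re (- s - 1) = - Re z - 2" using s by simp
      then show ?thesis using t0 norm_powr_real_powr[of "of_real t" "- s - 1"] by (simp only: norm_mult) simp
    qed
    also have "\<dots> \<le> (C * t) * t powr (- Re z - 2)"
    proof (rule mult_right_mono)
      have "\<bar>b\<bar> \<le> C * a" using b by (simp add: a_def)
      also have "\<dots> \<le> C * t" using t C by (intro mult_left_mono) auto
      finally show "\<bar>b\<bar> \<le> C * t" .
    qed auto
    also have "\<dots> = C * (t powr 1 * t powr (- Re z - 2))" using t0 by simp
    also have "t powr 1 * t powr (- Re z - 2) = t powr (- Re z - 1)" 
    proof -
      have "1 + (- Re z - 2) = - Re z - 1" by simp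
      then show ?thesis by (simp only: powr_add[symmetric])
    qed
    finally show "norm (of_real b * of_real t powr (- s - 1)) \<le> C * t powr (- Re z - 1)" .
  qed simp
  also have "f (a + 1) - f a = of_real b * step_weight n s"
    using s by (simp add: f_def step_weight_def a_def diff_divide_distrib algebra_simps)
  also have "\<phi> (a + 1) - \<phi> a = C * (exp (- (ln a * Re z)) - exp (- (ln (a + 1) * Re z))) / Re z"
    using a by (simp add: \<phi>_def powr_def algebra_simps diff_divide_distrib)
  finally show ?thesis by (simp add: s_def a_def add_ac)
qed

definition psi_error :: "nat \<Rightarrow> real" where
  "psi_error n = chebyshev_psi n - real n"

lemma psi_error_abel:
  fixes x :: "nat \<Rightarrow> complex"
  shows "(\<Sum>n<N. of_real (psi_error (Suc n)) * (x (Suc n) - x (Suc (Suc n)))) =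
    (\<Sum>n<N. (mangoldt (Suc n) - 1) * x (Suc n)) - of_real (psi_error N) * x (Suc N)"
proof (induction N)
  case (Suc N)
  have "psi_error (Suc N) = psi_error N + (mangoldt (Suc N) - 1)"
    by (simp add: psi_error_def chebyshev_psi_Suc)
  then have eq: "of_real (psi_error (Suc N)) = of_real (psi_error N) + (mangoldt (Suc N) - 1 :: complex)"
    by simp
  show ?case unfolding sum.lessThan_Suc Suc.IH eq by (simp add: algebra_simps)
qed (simp add: psi_error_def)

text \<open>Partial summation of the Dirichlet series with coefficients \<Lambda>(n) - 1, \<Lambda> being the
von Mangoldt function. The boundary term vanishes by Chebyshev's bound.\<close>
lemma psi_error_sums:
  assumes s: "Re s > 1"
  shows "(\<lambda>n. of_real (psi_error (Suc n)) * step_weight n s) sums ((mangoldt_series s - zeta_series s) / s)"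
proof -
  let ?x = "\<lambda>n. of_nat n powr (- s) :: complex"
  have "(\<lambda>n. mangoldt n * ?x n - 1 * ?x n) sums (mangoldt_series s - zeta_series s)"
    unfolding mangoldt_series_def zeta_series_def
    by (intro sums_diff dirichlet_series_sums summable_zeta summable_mangoldt s)
  then have "(\<lambda>n. mangoldt (Suc n) * ?x (Suc n) - 1 * ?x (Suc n)) sums (mangoldt_series s - zeta_series s)"
    by (subst sums_Suc_iff) simp
  then have l1: "(\<lambda>N. \<Sum>n<N. (mangoldt (Suc n) - 1) * ?x (Suc n)) \<longlonglongrightarrow> mangoldt_series s - zeta_series s"
    by (simp only: sums_def left_diff_distrib)
  have l2: "(\<lambda>N. of_real (psi_error N) * ?x (Suc N)) \<longlonglongrightarrow> 0"
  proof (rule Lim_null_comparison)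
    have "norm (of_real (psi_error N) * ?x (Suc N)) \<le> 3 * real (Suc N) powr (1 - Re s)" for N
    proof -
      have "norm (of_real (psi_error N) * ?x (Suc N)) = \<bar>psi_error N\<bar> * real (Suc N) powr (- Re s)"
        by (simp add: norm_mult norm_nat_powr del: of_nat_Suc)
      also have "\<dots> \<le> (3 * real (Suc N)) * real (Suc N) powr (- Re s)"
        using chebyshev_psi_minus_le[of N] by (intro mult_right_mono) (auto simp: psi_error_def)
      also have "\<dots> = 3 * (real (Suc N) powr 1 * real (Suc N) powr (- Re s))" by simp
      also have "\<dots> = 3 * real (Suc N) powr (1 - Re s)" unfolding powr_add[symmetric] by simp
      finally show ?thesis .
    qed
    then show "\<forall>\<^sub>F N in sequentially. norm (of_real (psi_error N) * ?x (Suc N)) \<le> 3 * real (Suc N) powr (1 - Re s)"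
      by (intro always_eventually allI)
    have "(\<lambda>N. real N powr (1 - Re s)) \<longlonglongrightarrow> 0"
      using s by (intro tendsto_neg_powr filterlim_real_sequentially) auto
    then have "(\<lambda>N. real (Suc N) powr (1 - Re s)) \<longlonglongrightarrow> 0" by (rule LIMSEQ_Suc)
    then show "(\<lambda>N. 3 * real (Suc N) powr (1 - Re s)) \<longlonglongrightarrow> 0" by (rule tendsto_mult_right_zero)
  qed
  have "(\<lambda>n. of_real (psi_error (Suc n)) * (?x (Suc n) - ?x (Suc (Suc n)))) sums 
      (mangoldt_series s - zeta_series s)"
    unfolding sums_def psi_error_abel[of ?x] using tendsto_diff[OF l1 l2] by (simp only: diff_0_right)
  then have "(\<lambda>n. of_real (psi_error (Suc n)) * (?x (Suc n) - ?x (Suc (Suc n))) / s) sums 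
      ((mangoldt_series s - zeta_series s) / s)"
    by (rule sums_divide)
  moreover have "s \<noteq> 0" using s by auto
  ultimately show ?thesis by (simp add: step_weight_def del: of_nat_Suc)
qed

text \<open>The continuation of - zeta'/zeta - zeta, written in terms of (s - 1) zeta(s) so that the poles at
s = 1 have already cancelled.\<close>
definition neg_log_deriv_minus_zeta :: "complex \<Rightarrow> complex" where
  "neg_log_deriv_minus_zeta s = - (if s = 1 then deriv zeta_pole 1 else (zeta_pole s - zeta_pole 1) / (s - 1))
     - deriv zeta_pole s / zeta_pole s"

lemma neg_log_deriv_minus_zeta_eq:
  assumes "Re s > 1"
  shows "neg_log_deriv_minus_zeta s = mangoldt_series s - zeta_series s"
proof -
  have s: "s \<noteq> 1" using assms by auto
  have "deriv zeta_pole s / zeta_pole s = 1 / (s - 1) - mangoldt_series s"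
    using deriv_zeta_pole[OF assms] zeta_pole_nonzero_right[OF assms] by simp
  moreover have "(zeta_pole s - zeta_pole 1) / (s - 1) = zeta_series s - 1 / (s - 1)"
    using s by (simp add: zeta_pole_eq[OF assms] diff_divide_distrib)
  ultimately show ?thesis using s by (simp add: neg_log_deriv_minus_zeta_def)
qed

lemma neg_log_deriv_minus_zeta_holomorphic:
  obtains S where "open S" "{s. Re s \<ge> 1} \<subseteq> S" "S \<subseteq> {s. Re s > 0}" "neg_log_deriv_minus_zeta holomorphic_on S"
proof
  let ?H = "{s. Re s > 0}"
  define S where "S = ?H \<inter> zeta_pole -` (- {0})"
  have op: "open ?H" by (rule open_halfspace_Re_gt)
  show "open S" unfolding S_def
    by (intro continuous_open_preimage holomorphic_on_imp_continuous_on[OF zeta_pole_holomorphic] op) auto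
  show "{s. Re s \<ge> 1} \<subseteq> S" using zeta_pole_nonzero by (auto simp: S_def)
  show SH: "S \<subseteq> ?H" by (auto simp: S_def)
  have 1: "(\<lambda>s. if s = 1 then deriv zeta_pole 1 else (zeta_pole s - zeta_pole 1) / (s - 1)) holomorphic_on S"
    by (rule holomorphic_on_subset[OF pole_lemma[OF zeta_pole_holomorphic] SH]) (simp add: interior_open[OF op])
  have 2: "(\<lambda>s. deriv zeta_pole s / zeta_pole s) holomorphic_on S"
    by (intro holomorphic_on_divide holomorphic_on_subset[OF zeta_pole_holomorphic SH]
        holomorphic_on_subset[OF holomorphic_deriv[OF zeta_pole_holomorphic op] SH]) (auto simp: S_def)
  show "neg_log_deriv_minus_zeta holomorphic_on S"
    unfolding neg_log_deriv_minus_zeta_def by (intro holomorphic_on_diff holomorphic_on_minus 1 2)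
qed

theorem chebyshev_psi_asymp: "(\<lambda>n. chebyshev_psi n / real n) \<longlonglongrightarrow> 1"
proof (rule mono_ratio_tendsto_1)
  obtain S where S: "open S" "{s. Re s \<ge> 1} \<subseteq> S" "S \<subseteq> {s. Re s > 0}" "neg_log_deriv_minus_zeta holomorphic_on S"
    by (rule neg_log_deriv_minus_zeta_holomorphic)
  let ?T = "(\<lambda>z. 1 + z) -` S"
  let ?w = "\<lambda>n z. of_real (psi_error (Suc n)) * step_weight n (1 + z)"
  let ?F = "\<lambda>z. neg_log_deriv_minus_zeta (1 + z) / (1 + z)"
  have shift: "(\<lambda>z. g (1 + z)) holomorphic_on ((\<lambda>z. 1 + z) -` A)" if "g holomorphic_on A" for g :: "complex \<Rightarrow> complex" and A
  proof -
    have "(g \<circ> (\<lambda>z. 1 + z)) holomorphic_on ((\<lambda>z. 1 + z) -` A)"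
      by (rule holomorphic_on_compose_gen[OF _ that]) (auto intro!: holomorphic_intros)
    then show ?thesis by (simp add: o_def)
  qed
  have "(\<lambda>n. ?w n 0) sums ?F 0"
  proof (rule newman_tauberian[where l = "\<lambda>n. ln (real (Suc n))" and C = 3 and S = ?T])
    show "?w n holomorphic_on UNIV" for n
      using shift[OF step_weight_holomorphic] by (auto intro!: holomorphic_intros)
    show "filterlim (\<lambda>n. ln (real (Suc n))) at_top sequentially"
      by (intro filterlim_compose[OF ln_at_top] filterlim_compose[OF filterlim_real_sequentially] filterlim_Suc)
    show "norm (?w n z) \<le> 3 * (exp (- (ln (real (Suc n)) * Re z)) - exp (- (ln (real (Suc (Suc n))) * Re z))) / Re z"
      if "Re z \<noteq> 0" for n z
      by (intro norm_step_weight_le that) (use chebyshev_psi_minus_le[of "Suc n"] in \<open>simp add: psi_error_def\<close>)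
    show "?F holomorphic_on ?T"
      by (intro holomorphic_on_divide shift S(4) holomorphic_intros) (use S(3) in auto)
    show "open ?T" by (intro open_vimage S continuous_intros)
    show "{z. Re z \<ge> 0} \<subseteq> ?T" using S(2) by (auto simp: subset_iff)
    show "(\<lambda>n. ?w n z) sums ?F z" if "Re z > 0" for z
      using psi_error_sums[of "1 + z"] neg_log_deriv_minus_zeta_eq[of "1 + z"] that by simp
  qed auto
  then have "summable (\<lambda>n. Re (?w n 0))" by (intro summable_Re) (rule sums_summable)
  also have "(\<lambda>n. Re (?w n 0)) = (\<lambda>n. (chebyshev_psi (Suc n) - real (Suc n)) / (real (Suc n) * (real (Suc n) + 1)))"
  proof
    fix n
    have "of_nat (Suc k) powr (- 1 :: complex) = of_real (1 / real (Suc k))" for k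
      by (simp add: powr_minus inverse_eq_divide del: of_nat_Suc)
    then have "step_weight n 1 = of_real (1 / real (Suc n) - 1 / real (Suc (Suc n)))"
      by (simp add: step_weight_def del: of_nat_Suc)
    then have "Re (?w n 0) = psi_error (Suc n) * (1 / real (Suc n) - 1 / real (Suc (Suc n)))"
      by (simp flip: of_real_mult del: of_nat_Suc)
    also have "1 / real (Suc n) - 1 / real (Suc (Suc n)) = 1 / (real (Suc n) * (real (Suc n) + 1))"
      by (simp add: field_simps)
    finally show "Re (?w n 0) = (chebyshev_psi (Suc n) - real (Suc n)) / (real (Suc n) * (real (Suc n) + 1))"
      by (simp add: psi_error_def)
  qed
  finally show "summable (\<lambda>n. (chebyshev_psi n - real n) / (real n * (real n + 1)))"
    by (subst (asm) summable_Suc_iff)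
qed (rule chebyshev_psi_mono)

section \<open>Prime counting and the sum of reciprocals of primes\<close>

definition primes_le :: "real \<Rightarrow> nat set" where
  "primes_le x = {p. prime p \<and> real p \<le> x}"

definition prime_count :: "real \<Rightarrow> real" where
  "prime_count x = real (card (primes_le x))"

definition prime_recip_sum :: "real \<Rightarrow> real" where
  "prime_recip_sum x = (\<Sum>p\<in>primes_le x. 1 / real p)"

lemma finite_nat_real_le: "finite {n::nat. real n \<le> x}"
  by (rule finite_subset[of _ "{..nat \<lfloor>x\<rfloor>}"]) (auto simp: le_nat_floor)

lemma finite_primes_le [simp]: "finite (primes_le x)"
  unfolding primes_le_def by (rule finite_subset[OF _ finite_nat_real_le[of x]]) auto

lemma primes_le_mono: "x \<le> y \<Longrightarrow> primes_le x \<subseteq> primes_le y"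
  by (auto simp: primes_le_def)

lemma prime_count_mono: "x \<le> y \<Longrightarrow> prime_count x \<le> prime_count y"
  unfolding prime_count_def by (simp add: card_mono primes_le_mono)

lemma prime_count_nonneg: "prime_count x \<ge> 0"
  by (simp add: prime_count_def)

lemma prime_count_le: "x \<ge> 0 \<Longrightarrow> prime_count x \<le> x"
proof -
  assume x: "x \<ge> 0"
  have "primes_le x \<subseteq> {1..nat \<lfloor>x\<rfloor>}"
    using prime_gt_0_nat by (force simp: primes_le_def le_nat_floor Suc_le_eq)
  then have "card (primes_le x) \<le> nat \<lfloor>x\<rfloor>"
    using card_mono[of "{1..nat \<lfloor>x\<rfloor>}"] by fastforce
  then show ?thesis unfolding prime_count_def using x by linarith
qed

lemma primes_le_nat: "primes_le (real n) = {p. prime p \<and> p \<le> n}"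
  by (auto simp: primes_le_def)

lemma primes_le_floor: "x \<ge> 0 \<Longrightarrow> primes_le x = primes_le (real (nat \<lfloor>x\<rfloor>))"
proof -
  assume x: "x \<ge> 0"
  have "real p \<le> x \<longleftrightarrow> real p \<le> real (nat \<lfloor>x\<rfloor>)" for p
  proof
    assume "real p \<le> x"
    then show "real p \<le> real (nat \<lfloor>x\<rfloor>)" using le_nat_floor by (simp only: of_nat_le_iff)
  next
    assume "real p \<le> real (nat \<lfloor>x\<rfloor>)"
    then show "real p \<le> x" using of_nat_floor[OF x] by (rule order_trans)
  qed
  then show ?thesis unfolding primes_le_def by simp
qed

text \<open>A prime p contributes ln p to \<psi>(n) for each of its powers up to n, in total at most ln n.\<close>
lemma chebyshev_psi_le_prime_count:
  assumes n: "n > 0"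
  shows "chebyshev_psi n \<le> prime_count (real n) * ln (real n)"
proof -
  define D where "D = {d \<in> {1..n}. primepow d}"
  let ?P = "primes_le (real n)"
  have fin: "finite D" by (simp add: D_def)
  have decomp: "\<exists>k>0. prime (aprimedivisor d) \<and> d = aprimedivisor d ^ k" if pd: "primepow d" for d :: nat
  proof -
    obtain p k where "prime p" "k > 0" "d = p ^ k" using pd by (auto simp: primepow_def)
    then show ?thesis using aprimedivisor_prime_power[of p k] by auto
  qed
  have sub: "aprimedivisor ` D \<subseteq> ?P"
  proof
    fix p assume "p \<in> aprimedivisor ` D"
    then obtain d where d: "d \<in> {1..n}" "primepow d" "p = aprimedivisor d" by (auto simp: D_def)
    then obtain k where "k > 0" "prime p" "d = p ^ k" using decomp[OF d(2)] unfolding d(3)[symmetric] by blast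
    then have "p dvd d" by simp
    then have "p \<le> n" using d(1) dvd_imp_le[of p d] by auto
    then show "p \<in> ?P" using \<open>prime p\<close> by (simp add: primes_le_nat)
  qed
  have "chebyshev_psi n = (\<Sum>d\<in>D. ln (real (aprimedivisor d)))"
    unfolding chebyshev_psi_def by (intro sum.mono_neutral_cong_right) (auto simp: D_def mangoldt_def)
  also have "\<dots> = (\<Sum>p\<in>?P. \<Sum>d\<in>{d\<in>D. aprimedivisor d = p}. ln (real (aprimedivisor d)))"
    by (rule sum.group[symmetric, OF fin _ sub]) simp
  also have "\<dots> \<le> (\<Sum>p\<in>?P. ln (real n))"
  proof (rule sum_mono)
    fix p assume p: "p \<in> ?P"
    then have pp: "prime p" by (auto simp: primes_le_def)
    have p1: "p > 1" using pp by (rule prime_gt_1_nat)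
    then have lnp: "ln (real p) > 0" by simp
    define K where "K = nat \<lfloor>ln (real n) / ln (real p)\<rfloor>"
    have K: "real K * ln (real p) \<le> ln (real n)"
    proof -
      have "real K \<le> ln (real n) / ln (real p)" unfolding K_def using n lnp
        by (intro of_nat_floor) auto
      then show ?thesis using lnp by (simp add: field_simps)
    qed
    have "{d\<in>D. aprimedivisor d = p} \<subseteq> (\<lambda>k. p ^ k) ` {1..K}"
    proof
      fix d assume "d \<in> {d\<in>D. aprimedivisor d = p}"
      then have d: "primepow d" "d \<le> n" "aprimedivisor d = p" by (auto simp: D_def)
      obtain k where k: "d = p ^ k" "k > 0" using decomp[OF d(1)] unfolding d(3) by blast
      have "real k * ln (real p) = ln (real d)" using k p1 by (simp add: ln_realpow)
      also have "\<dots> \<le> ln (real n)" using d k p1 n by (subst ln_le_cancel_iff) auto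
      finally have "real k \<le> ln (real n) / ln (real p)" using lnp by (simp add: field_simps)
      then have "k \<le> K" unfolding K_def by (rule le_nat_floor)
      then show "d \<in> (\<lambda>k. p ^ k) ` {1..K}" using k by auto
    qed
    then have "card {d\<in>D. aprimedivisor d = p} \<le> card {1..K}"
      by (rule surj_card_le[rotated]) simp
    then have c: "real (card {d\<in>D. aprimedivisor d = p}) \<le> real K" by simp
    have "(\<Sum>d\<in>{d\<in>D. aprimedivisor d = p}. ln (real (aprimedivisor d))) = 
        real (card {d\<in>D. aprimedivisor d = p}) * ln (real p)"
      by simp
    also have "\<dots> \<le> real K * ln (real p)" using c lnp by (intro mult_right_mono) auto
    finally show "(\<Sum>d\<in>{d\<in>D. aprimedivisor d = p}. ln (real (aprimedivisor d))) \<le> ln (real n)"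
      using K by linarith
  qed
  finally show ?thesis by (simp add: prime_count_def)
qed

text \<open>At most y primes are \<le> y, and every other one contributes at least ln y to \<psi>(n).\<close>
lemma prime_count_le_chebyshev_psi:
  assumes y: "y > 1" and n: "y \<le> real n"
  shows "prime_count (real n) \<le> y + chebyshev_psi n / ln y"
proof -
  let ?A = "primes_le (real n) - primes_le y"
  have "real (card ?A) * ln y \<le> (\<Sum>p\<in>?A. mangoldt p)"
  proof (rule sum_bounded_below)
    fix p assume "p \<in> ?A"
    then show "ln y \<le> mangoldt p" using y by (auto simp: primes_le_def)
  qed
  also have "\<dots> \<le> chebyshev_psi n" unfolding chebyshev_psi_def
    using prime_gt_0_nat by (intro sum_mono2) (force simp: primes_le_def Suc_le_eq intro: mangoldt_nonneg)+
  finally have "real (card ?A) \<le> chebyshev_psi n / ln y" using y by (simp add: field_simps)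
  moreover have "card ?A = card (primes_le (real n)) - card (primes_le y)"
    by (intro card_Diff_subset primes_le_mono n) simp
  moreover have "prime_count y \<le> y" using y by (intro prime_count_le) auto
  ultimately show ?thesis unfolding prime_count_def by linarith
qed

theorem prime_number_theorem: "((\<lambda>x. prime_count x * ln x / x) \<longlongrightarrow> 1) at_top"
proof (rule tendsto_sandwich)
  have nf: "filterlim (\<lambda>x::real. nat \<lfloor>x\<rfloor>) sequentially at_top"
    unfolding filterlim_at_top
    using le_nat_floor by (auto intro!: eventually_mono[OF eventually_ge_at_top])
  have "((\<lambda>x. real (nat \<lfloor>x\<rfloor>) / x) \<longlongrightarrow> 1) at_top"
  proof (rule tendsto_sandwich)
    show "\<forall>\<^sub>F x::real in at_top. (x - 1) / x \<le> real (nat \<lfloor>x\<rfloor>) / x"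
      using eventually_gt_at_top[of 0] by eventually_elim (intro divide_right_mono; linarith)
    show "\<forall>\<^sub>F x::real in at_top. real (nat \<lfloor>x\<rfloor>) / x \<le> 1"
      using eventually_gt_at_top[of 0] by eventually_elim simp
  qed real_asymp+
  then have "((\<lambda>x. chebyshev_psi (nat \<lfloor>x\<rfloor>) / real (nat \<lfloor>x\<rfloor>) * (real (nat \<lfloor>x\<rfloor>) / x)) \<longlongrightarrow> 1 * 1) at_top"
    by (intro tendsto_mult filterlim_compose[OF chebyshev_psi_asymp nf])
  then have "((\<lambda>x. chebyshev_psi (nat \<lfloor>x\<rfloor>) / real (nat \<lfloor>x\<rfloor>) * (real (nat \<lfloor>x\<rfloor>) / x)) \<longlongrightarrow> 1) at_top" by simp
  then show psi: "((\<lambda>x. chebyshev_psi (nat \<lfloor>x\<rfloor>) / x) \<longlongrightarrow> 1) at_top"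
    by (rule Lim_transform_eventually) (auto intro!: eventually_mono[OF eventually_ge_at_top[of 1]])
  have floor_count: "prime_count x = prime_count (real (nat \<lfloor>x\<rfloor>))" if "x \<ge> 0" for x
    using primes_le_floor[OF that] by (simp add: prime_count_def)
  show "\<forall>\<^sub>F x in at_top. chebyshev_psi (nat \<lfloor>x\<rfloor>) / x \<le> prime_count x * ln x / x"
    using eventually_ge_at_top[of 1]
  proof eventually_elim
    case (elim x)
    have "chebyshev_psi (nat \<lfloor>x\<rfloor>) \<le> prime_count x * ln (real (nat \<lfloor>x\<rfloor>))"
      unfolding floor_count[OF order_trans[OF zero_le_one elim]]
      using elim by (intro chebyshev_psi_le_prime_count) simp
    also have "\<dots> \<le> prime_count x * ln x"
      using elim prime_count_nonneg by (intro mult_left_mono ln_mono) auto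
    finally show ?case using elim by (intro divide_right_mono) auto
  qed
  \<comment> \<open>Small enough that ?y x = o(x / ln x), yet ln (?y x) is asymptotic to ln x.\<close>
  let ?y = "\<lambda>x::real. x / (ln x)\<^sup>2"
  show "\<forall>\<^sub>F x in at_top. prime_count x * ln x / x \<le> 1 / ln x + chebyshev_psi (nat \<lfloor>x\<rfloor>) / x * (ln x / ln (?y x))"
  proof -
    have "\<forall>\<^sub>F x::real in at_top. ?y x > 1" "\<forall>\<^sub>F x::real in at_top. ?y x \<le> x - 1" by real_asymp+
    with eventually_gt_at_top[of 1] show ?thesis
    proof eventually_elim
      case (elim x)
      have "?y x \<le> real (nat \<lfloor>x\<rfloor>)" using elim by linarith
      then have "prime_count x \<le> ?y x + chebyshev_psi (nat \<lfloor>x\<rfloor>) / ln (?y x)"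
        using prime_count_le_chebyshev_psi[of "?y x" "nat \<lfloor>x\<rfloor>"] floor_count[of x] elim by simp
      then have "prime_count x * ln x / x \<le> (?y x + chebyshev_psi (nat \<lfloor>x\<rfloor>) / ln (?y x)) * ln x / x"
        using elim by (intro divide_right_mono mult_right_mono) auto
      also have "\<dots> = 1 / ln x + chebyshev_psi (nat \<lfloor>x\<rfloor>) / x * (ln x / ln (?y x))"
      proof -
        have "ln x > 0" using elim by simp
        then show ?thesis using elim(1) by (simp add: add_divide_distrib distrib_right power2_eq_square)
      qed
      finally show ?case .
    qed
  qed
  have "((\<lambda>x. 1 / ln x + chebyshev_psi (nat \<lfloor>x\<rfloor>) / x * (ln x / ln (?y x))) \<longlongrightarrow> 0 + 1 * 1) at_top"
    by (intro tendsto_add tendsto_mult psi) real_asymp+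
  then show "((\<lambda>x. 1 / ln x + chebyshev_psi (nat \<lfloor>x\<rfloor>) / x * (ln x / ln (?y x))) \<longlongrightarrow> 1) at_top" by simp
qed

lemma stolz_cesaro:
  fixes a b :: "nat \<Rightarrow> real"
  assumes mono: "\<forall>\<^sub>F n in sequentially. b n < b (Suc n)" and b: "filterlim b at_top sequentially"
    and lim: "(\<lambda>n. (a (Suc n) - a n) / (b (Suc n) - b n)) \<longlonglongrightarrow> L"
  shows "(\<lambda>n. a n / b n) \<longlonglongrightarrow> L"
proof (rule tendstoI)
  fix e :: real assume e: "e > 0"
  have "\<forall>\<^sub>F n in sequentially. dist ((a (Suc n) - a n) / (b (Suc n) - b n)) L < e / 2"
    using tendstoD[OF lim, of "e / 2"] e by simp
  with mono have "\<forall>\<^sub>F n in sequentially. b n < b (Suc n) \<and> dist ((a (Suc n) - a n) / (b (Suc n) - b n)) L < e / 2"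
    by (rule eventually_conj)
  then obtain N where N: "\<And>n. n \<ge> N \<Longrightarrow> b n < b (Suc n)"
    "\<And>n. n \<ge> N \<Longrightarrow> dist ((a (Suc n) - a n) / (b (Suc n) - b n)) L < e / 2"
    unfolding eventually_sequentially by blast
  have step: "\<bar>(a (Suc n) - L * b (Suc n)) - (a n - L * b n)\<bar> \<le> e / 2 * (b (Suc n) - b n)" if "n \<ge> N" for n
  proof -
    have "(a (Suc n) - L * b (Suc n)) - (a n - L * b n) = 
       ((a (Suc n) - a n) / (b (Suc n) - b n) - L) * (b (Suc n) - b n)"
    proof -
      have "(a (Suc n) - a n) / (b (Suc n) - b n) * (b (Suc n) - b n) = a (Suc n) - a n"
        using N(1)[OF that] by simp
      then show ?thesis unfolding left_diff_distrib[of "(a (Suc n) - a n) / (b (Suc n) - b n)"]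
        by (simp only:) (simp add: algebra_simps)
    qed
    then show ?thesis using N[OF that] by (simp add: abs_mult dist_real_def)
  qed
  define c where "c = \<bar>a N - L * b N\<bar> + e / 2 * \<bar>b N\<bar>"
  have tele: "\<bar>a n - L * b n\<bar> \<le> \<bar>a N - L * b N\<bar> + e / 2 * (b n - b N)" if "n \<ge> N" for n
    using that
  proof (induction n rule: dec_induct)
    case (step n)
    have "e / 2 * (b (Suc n) - b N) = e / 2 * (b n - b N) + e / 2 * (b (Suc n) - b n)"
      unfolding distrib_left[symmetric] by simp
    then show ?case using step.IH \<open>n \<ge> N\<close> \<open>\<And>n. n \<ge> N \<Longrightarrow> \<bar>(a (Suc n) - L * b (Suc n)) - (a n - L * b n)\<bar> \<le> e / 2 * (b (Suc n) - b n)\<close>[of n]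
      by linarith
  qed simp
  have "((\<lambda>n. c / b n) \<longlongrightarrow> 0) sequentially"
    by (intro tendsto_divide_0[OF tendsto_const] filterlim_at_top_imp_at_infinity b)
  then have "\<forall>\<^sub>F n in sequentially. c / b n < e / 2" using e by (intro order_tendstoD(2)) auto
  moreover have "\<forall>\<^sub>F n in sequentially. b n > 0" using b by (simp add: filterlim_at_top_dense)
  ultimately show "\<forall>\<^sub>F n in sequentially. dist (a n / b n) L < e"
    using eventually_ge_at_top[of N]
  proof eventually_elim
    case (elim n)
    have "e / 2 * (b n - b N) \<le> e / 2 * b n + e / 2 * \<bar>b N\<bar>"
      unfolding distrib_left[symmetric] using e by (intro mult_left_mono) auto
    then have "\<bar>a n - L * b n\<bar> \<le> c + e / 2 * b n" using tele[OF elim(3)] by (simp add: c_def)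
    moreover have "c < e / 2 * b n" using elim by (simp add: field_simps)
    ultimately have "\<bar>a n - L * b n\<bar> < e * b n" by simp
    moreover have "a n / b n - L = (a n - L * b n) / b n" using elim by (simp add: field_simps)
    ultimately show ?case using elim by (simp add: dist_real_def abs_divide field_simps)
  qed
qed

text \<open>The left side is the increment of a partial summation: adding a prime n + 1 to the sum of reciprocals is
offset by the jump of \<pi>.\<close>
lemma prime_recip_sum_Suc:
  assumes n: "n > 0"
  shows "(prime_recip_sum (real (Suc n)) - prime_count (real (Suc n)) / real (Suc n))
     - (prime_recip_sum (real n) - prime_count (real n) / real n) = prime_count (real n) / (real n * real (Suc n))"
proof -
  have e: "prime_count (real n) / real n - prime_count (real n) / real (Suc n) = prime_count (real n) / (real n * real (Suc n))"
    using n by (simp add: field_simps)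
  show ?thesis
  proof (cases "prime (Suc n)")
    case True
    have ins: "primes_le (real (Suc n)) = insert (Suc n) (primes_le (real n))"
      unfolding primes_le_nat using True by (auto simp: le_Suc_eq)
    have new: "Suc n \<notin> primes_le (real n)" by (simp add: primes_le_def)
    show ?thesis using new e
      by (simp add: prime_recip_sum_def prime_count_def ins add_divide_distrib of_nat_Suc[of "card A" for A] del: of_nat_Suc)
  next
    case False
    have "primes_le (real (Suc n)) = primes_le (real n)"
      unfolding primes_le_nat using False by (auto simp: le_Suc_eq)
    then show ?thesis using e by (simp add: prime_recip_sum_def prime_count_def)
  qed
qed

text \<open>By partial summation the sum of 1/p is the sum of \<pi>(n) / (n (n + 1)) up to a bounded term; by the prime number theorem
these terms are asymptotic to the increments of ln (ln n).\<close>
theorem prime_recip_sum_asymp: "((\<lambda>x. prime_recip_sum x / ln (ln x)) \<longlongrightarrow> 1) at_top"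
proof -
  define a where "a = (\<lambda>n. prime_recip_sum (real n) - prime_count (real n) / real n)"
  have pnt: "(\<lambda>n. prime_count (real n) * ln (real n) / real n) \<longlonglongrightarrow> 1"
    by (rule filterlim_compose[OF prime_number_theorem filterlim_real_sequentially])
  have "(\<lambda>n. a n / ln (ln (real n))) \<longlonglongrightarrow> 1"
  proof (rule stolz_cesaro)
    show "\<forall>\<^sub>F n in sequentially. ln (ln (real n)) < ln (ln (real (Suc n)))" by real_asymp
    show "filterlim (\<lambda>n. ln (ln (real n))) at_top sequentially" by real_asymp
    have "(\<lambda>n. 1 / (ln (real n) * real (Suc n) * (ln (ln (real (Suc n))) - ln (ln (real n))))) \<longlonglongrightarrow> 1"
      by real_asymp
    from tendsto_mult[OF pnt this]
    have "(\<lambda>n. prime_count (real n) * ln (real n) / real n * 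
       (1 / (ln (real n) * real (Suc n) * (ln (ln (real (Suc n))) - ln (ln (real n)))))) \<longlonglongrightarrow> 1" by simp
    then show "(\<lambda>n. (a (Suc n) - a n) / (ln (ln (real (Suc n))) - ln (ln (real n)))) \<longlonglongrightarrow> 1"
    proof (rule Lim_transform_eventually)
      show "\<forall>\<^sub>F n in sequentially. prime_count (real n) * ln (real n) / real n * 
         (1 / (ln (real n) * real (Suc n) * (ln (ln (real (Suc n))) - ln (ln (real n))))) =
         (a (Suc n) - a n) / (ln (ln (real (Suc n))) - ln (ln (real n)))"
        using eventually_gt_at_top[of 1]
      proof eventually_elim
        case (elim n)
        then have "ln (real n) > 0" by simp
        then show ?case unfolding a_def using elim by (subst prime_recip_sum_Suc) auto
      qed
    qed
  qed
  moreover have "(\<lambda>n. prime_count (real n) / real n / ln (ln (real n))) \<longlonglongrightarrow> 0"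
  proof -
    have "(\<lambda>n. 1 / (ln (real n) * ln (ln (real n)))) \<longlonglongrightarrow> 0" by real_asymp
    from tendsto_mult[OF pnt this]
    have "(\<lambda>n. prime_count (real n) * ln (real n) / real n * (1 / (ln (real n) * ln (ln (real n))))) \<longlonglongrightarrow> 0" by simp
    then show ?thesis
      by (rule Lim_transform_eventually) (use eventually_gt_at_top[of 1] in eventually_elim, simp)
  qed
  ultimately have "(\<lambda>n. a n / ln (ln (real n)) + prime_count (real n) / real n / ln (ln (real n))) \<longlonglongrightarrow> 1 + 0"
    by (rule tendsto_add)
  then have nat: "(\<lambda>n. prime_recip_sum (real n) / ln (ln (real n))) \<longlonglongrightarrow> 1"
    by (simp add: a_def diff_divide_distrib)
  have nf: "filterlim (\<lambda>x::real. nat \<lfloor>x\<rfloor>) sequentially at_top"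
    unfolding filterlim_at_top
    using le_nat_floor by (auto intro!: eventually_mono[OF eventually_ge_at_top])
  have "((\<lambda>x. ln (ln (real (nat \<lfloor>x\<rfloor>))) / ln (ln x)) \<longlongrightarrow> 1) at_top"
  proof (rule tendsto_sandwich)
    have "\<forall>\<^sub>F x::real in at_top. ln (ln (x - 1)) > 0" by real_asymp
    with eventually_gt_at_top[of 4] 
    have ev: "\<forall>\<^sub>F x::real in at_top. x > 4 \<and> ln (ln (x - 1)) > 0 \<and> ln (ln x) > 0"
    proof eventually_elim
      case (elim x)
      have "ln (x - 1) > 0" "ln x > ln (x - 1)" using elim by auto
      then have "ln (ln x) > ln (ln (x - 1))" by (subst ln_less_cancel_iff) auto
      then show ?case using elim by linarith
    qed
    show "\<forall>\<^sub>F x::real in at_top. ln (ln (x - 1)) / ln (ln x) \<le> ln (ln (real (nat \<lfloor>x\<rfloor>))) / ln (ln x)"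
      using ev
    proof eventually_elim
      case (elim x)
      have "x - 1 \<le> real (nat \<lfloor>x\<rfloor>)" by linarith
      then have "ln (x - 1) \<le> ln (real (nat \<lfloor>x\<rfloor>))" using elim by (intro ln_mono) auto
      then have "ln (ln (x - 1)) \<le> ln (ln (real (nat \<lfloor>x\<rfloor>)))" using elim by (intro ln_mono) auto
      then show ?case using elim by (intro divide_right_mono) auto
    qed
    show "\<forall>\<^sub>F x::real in at_top. ln (ln (real (nat \<lfloor>x\<rfloor>))) / ln (ln x) \<le> 1"
      using ev
    proof eventually_elim
      case (elim x)
      have fl: "real (nat \<lfloor>x\<rfloor>) \<le> x" "real (nat \<lfloor>x\<rfloor>) > 1" using elim by linarith+
      then have "ln (real (nat \<lfloor>x\<rfloor>)) \<le> ln x" "ln (real (nat \<lfloor>x\<rfloor>)) > 0"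
        using ln_mono[of "real (nat \<lfloor>x\<rfloor>)" x] by auto
      then have "ln (ln (real (nat \<lfloor>x\<rfloor>))) \<le> ln (ln x)" by (rule ln_mono)
      then show ?case using elim by simp
    qed
  qed real_asymp+
  from tendsto_mult[OF filterlim_compose[OF nat nf] this]
  have "((\<lambda>x. prime_recip_sum (real (nat \<lfloor>x\<rfloor>)) / ln (ln (real (nat \<lfloor>x\<rfloor>))) * 
     (ln (ln (real (nat \<lfloor>x\<rfloor>))) / ln (ln x))) \<longlongrightarrow> 1) at_top" by simp
  then show ?thesis
  proof (rule Lim_transform_eventually)
    have "\<forall>\<^sub>F n in sequentially. ln (ln (real n)) > 0" by real_asymp
    then have "\<forall>\<^sub>F x::real in at_top. ln (ln (real (nat \<lfloor>x\<rfloor>))) > 0"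
      using nf by (rule eventually_compose_filterlim)
    with eventually_ge_at_top[of 0]
    show "\<forall>\<^sub>F x in at_top. prime_recip_sum (real (nat \<lfloor>x\<rfloor>)) / ln (ln (real (nat \<lfloor>x\<rfloor>))) * 
      (ln (ln (real (nat \<lfloor>x\<rfloor>))) / ln (ln x)) = prime_recip_sum x / ln (ln x)"
    proof eventually_elim
      case (elim x)
      then show ?case using primes_le_floor[of x] by (simp add: prime_recip_sum_def)
    qed
  qed
qed

section \<open>Large divisors in arithmetic progression\<close>

lemma least_prime_factor:
  assumes "n > (1::nat)"
  obtains p m where "prime p" "n = p * m" "m > 1 \<Longrightarrow> p \<le> m" "\<And>q. prime q \<Longrightarrow> q dvd n \<Longrightarrow> p \<le> q"
proof -
  define p where "p = (LEAST p. prime p \<and> p dvd n)"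
  have "n \<noteq> 1" using assms by simp
  then obtain p0 where "prime p0 \<and> p0 dvd n" using prime_factor_nat by blast
  then have p: "prime p \<and> p dvd n" unfolding p_def by (rule LeastI)
  have least: "p \<le> q" if "prime q" "q dvd n" for q
    unfolding p_def using that by (intro Least_le conjI)
  obtain m where m: "n = p * m" using p by (elim conjE dvdE)
  have "p \<le> m" if m1: "m > 1"
  proof -
    have "m \<noteq> 1" using m1 by simp
    then obtain q where q: "prime q" "q dvd m" using prime_factor_nat by blast
    have "p \<le> q" by (rule least[OF q(1)]) (simp add: m q(2))
    also have "q \<le> m" using q(2) m1 by (intro dvd_imp_le) auto
    finally show ?thesis .
  qed
  from that[OF conjunct1[OF p] m this least] show thesis .
qed

text \<open>For n = a b the condition sqrt n \<le> b says that b is at least its complementary divisor a.\<close>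
lemma mem_large_divisors_iff:
  assumes "n = a * b" "n > 0"
  shows "b \<in> large_divisors n \<longleftrightarrow> a \<le> b"
proof -
  have "sqrt (real n) \<le> real b \<longleftrightarrow> n \<le> b ^ 2"
  proof -
    have "real b = sqrt (real (b ^ 2))" by simp
    then show ?thesis by (metis real_sqrt_le_iff of_nat_le_iff)
  qed
  also have "\<dots> \<longleftrightarrow> a \<le> b" using assms by (auto simp: power2_eq_square)
  finally show ?thesis using assms by (auto simp: large_divisors_def)
qed

lemma self_mem_large_divisors: "n > 0 \<Longrightarrow> n \<in> large_divisors n"
  using mem_large_divisors_iff[of n 1 n] by auto

text \<open>With three terms, n - a would be a proper divisor of n, hence n - a \<le> n/2 and n - 2a \<le> 0.\<close>
lemma large_divisors_AP_card:
  assumes n: "n > 0" and AP: "forms_AP (large_divisors n)"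
  shows "card (large_divisors n) \<le> 2"
proof -
  have nL: "n \<in> large_divisors n" using n by (rule self_mem_large_divisors)
  then obtain d a k where dak: "0 < d" "0 < a" "0 < k" "large_divisors n = {d + i * a | i. i < k}"
    using AP unfolding forms_AP_def by blast
  have "k \<le> 2"
  proof (rule ccontr)
    assume "\<not> k \<le> 2"
    then have k: "k > 2" by simp
    obtain j where j: "n = d + j * a" "j < k" using nL dak by auto
    have mem: "d + i * a \<in> large_divisors n" if "i < k" for i using that dak by auto
    have "d + (k - 1) * a \<le> n" using mem[of "k - 1"] k by (auto simp: large_divisors_def)
    then have "(k - 1) * a \<le> j * a" using j by simp
    then have "k - 1 \<le> j" using dak by simp
    \<comment> \<open>So n is the last of the k terms, and n - a and n - 2a still belong to the progression.\<close>
    then have jk: "j = Suc (Suc (k - 3))" using j k by simp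
    have n_eq: "n = d + (k - 3) * a + 2 * a" using j jk by simp
    have "d + (k - 2) * a \<in> large_divisors n" by (rule mem) (use k in simp)
    moreover have "d + (k - 2) * a = n - a" 
    proof -
      have "k - 2 = Suc (k - 3)" using k by simp
      then show ?thesis using n_eq by simp
    qed
    ultimately have "(n - a) dvd n" by (auto simp: large_divisors_def)
    then obtain c where c: "n = (n - a) * c" by (rule dvdE)
    have lt: "a < n" "2 * a < n" using n_eq dak by auto
    have "c \<noteq> 0"
    proof
      assume "c = 0"
      with c have "n = 0" by simp
      with n show False by simp
    qed
    moreover have "c \<noteq> 1" using c lt dak by auto
    ultimately have "c \<ge> 2" by linarith
    then have "(n - a) * 2 \<le> n" using c by (metis mult_le_mono2)
    then show False using lt by linarith
  qed
  have "large_divisors n = (\<lambda>i. d + i * a) ` {..<k}" using dak by auto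
  then have "card (large_divisors n) \<le> card {..<k}" using card_image_le[of "{..<k}"] by simp
  then show ?thesis using \<open>k \<le> 2\<close> by simp
qed

text \<open>Let p be the least prime factor, n = p m and q the least prime factor of m, m = q r. Both n and
m are large divisors. If r > 1 then p r is large too, which forces q = p; comparing r with p^2 then
produces one more large divisor unless n = p^3.\<close>
lemma large_divisors_card_le_2:
  assumes n: "n > 1" and card: "card (large_divisors n) \<le> 2"
  shows "prime n \<or> (\<exists>p. prime p \<and> n = p ^ 2) \<or> (\<exists>p. prime p \<and> n = p ^ 3) 
     \<or> (\<exists>p q. prime p \<and> prime q \<and> p < q \<and> n = p * q)"
proof -
  have three: "x = y \<or> y = z \<or> x = z" 
    if "x \<in> large_divisors n" "y \<in> large_divisors n" "z \<in> large_divisors n" for x y z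
  proof (rule ccontr)
    assume "\<not> (x = y \<or> y = z \<or> x = z)"
    then have "card {x, y, z} = 3" by simp
    moreover have "finite (large_divisors n)" by (rule finite_subset[of _ "{..n}"]) (auto simp: large_divisors_def)
    then have "card {x, y, z} \<le> card (large_divisors n)" using that by (intro card_mono) auto
    ultimately show False using card by simp
  qed
  obtain p m where pm: "prime p" "n = p * m" "m > 1 \<Longrightarrow> p \<le> m" "\<And>q. prime q \<Longrightarrow> q dvd n \<Longrightarrow> p \<le> q"
    using least_prime_factor[OF n] by metis
  have p1: "p > 1" using pm(1) by (rule prime_gt_1_nat)
  have nL: "n \<in> large_divisors n" using n by (intro self_mem_large_divisors) auto
  show ?thesis
  proof (cases "m > 1")
    case False
    then have "m = 1" using n pm(2) by (cases m) auto
    then show ?thesis using pm by simp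
  next
    case m1: True
    have mL: "m \<in> large_divisors n" using mem_large_divisors_iff[OF pm(2)] pm(3) m1 n by simp
    obtain q r where qr: "prime q" "m = q * r" "r > 1 \<Longrightarrow> q \<le> r"
      using least_prime_factor[OF m1] by metis
    have q1: "q > 1" using qr(1) by (rule prime_gt_1_nat)
    have pq: "p \<le> q" by (rule pm(4)[OF qr(1)]) (simp add: pm(2) qr(2))
    show ?thesis
    proof (cases "r > 1")
      case False
      then have "r = 1" using m1 qr(2) by (cases r) auto
      then have n_pq: "n = p * q" using pm(2) qr(2) by simp
      show ?thesis
      proof (cases "p = q")
        case True
        then have "n = p ^ 2" using n_pq by (simp add: power2_eq_square)
        then show ?thesis using pm(1) by blast
      next
        case False
        then have "p < q" using pq by simp
        then show ?thesis using n_pq pm(1) qr(1) by blast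
      qed
    next
      case r1: True
      have "q \<le> p * r" using qr(3)[OF r1] p1 le_trans[of q r "p * r"] by simp
      then have "p * r \<in> large_divisors n"
        using mem_large_divisors_iff[of n q "p * r"] p1 q1 r1 by (simp add: pm(2) qr(2))
      from three[OF nL mL this] have "n = m \<or> m = p * r \<or> n = p * r" .
      moreover have "n \<noteq> m" unfolding pm(2) using p1 m1 by simp
      moreover have "n \<noteq> p * r" unfolding pm(2) qr(2) using p1 q1 r1 by simp
      ultimately have mpr: "m = p * r" by blast
      then have "q = p" using qr(2) r1 by simp
      have n_eq: "n = p * p * r" unfolding pm(2) mpr by simp
      have pr: "p \<le> r" using qr(3)[OF r1] \<open>q = p\<close> by simp
      have pp: "p < p * p" using p1 by simp
      have pn: "p * p < p * p * r" "r < p * p * r"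
        using p1 r1 less_1_mult[OF p1 p1] by simp_all
      show ?thesis
      proof (cases "p * p \<le> r")
        case True
        then have "r \<in> large_divisors n" using mem_large_divisors_iff[OF n_eq] n by simp
        from three[OF nL mL this] have "n = m \<or> m = r \<or> n = r" .
        moreover have "m \<noteq> r" unfolding mpr using p1 r1 by simp
        ultimately show ?thesis using \<open>n \<noteq> m\<close> pn(2) n_eq by simp
      next
        case False
        have "n = r * (p * p)" unfolding n_eq by simp
        then have "p * p \<in> large_divisors n" using mem_large_divisors_iff[of n r "p * p"] n False p1 r1 by simp
        from three[OF nL mL this] have "n = m \<or> m = p * p \<or> n = p * p" .
        then have "m = p * p" using \<open>n \<noteq> m\<close> pn(1) n_eq by linarith
        then have "r = p" using mpr p1 by simp
        then have "n = p ^ 3" using n_eq by (simp add: power3_eq_cube)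
        then show ?thesis using pm(1) by blast
      qed
    qed
  qed
qed

lemma semiprime_large_divisors_AP:
  assumes p: "prime p" and q: "prime q" and pq: "p < q"
  shows "forms_AP (large_divisors (p * q))"
proof -
  have p1: "p > 1" and q1: "q > 1" using p q prime_gt_1_nat by auto
  then have pq1: "p * q > 1" by (rule less_1_mult)
  have "large_divisors (p * q) = {q, p * q}"
  proof (intro equalityI subsetI)
    fix x assume x: "x \<in> large_divisors (p * q)"
    then have "x dvd p * q" by (simp add: large_divisors_def)
    from division_decomp[OF this] obtain a b where ab: "x = a * b" "a dvd p" "b dvd q" by (elim exE conjE)
    then have "a = 1 \<or> a = p" "b = 1 \<or> b = q" using p q by (auto simp: prime_nat_iff)
    moreover have "x \<noteq> 1" using x mem_large_divisors_iff[of "p * q" "p * q" 1] pq1 p1 q1 by auto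
    moreover have "x \<noteq> p" using x mem_large_divisors_iff[of "p * q" q p] p1 q1 pq by auto
    ultimately show "x \<in> {q, p * q}" using ab by auto
  next
    fix x assume "x \<in> {q, p * q}"
    then show "x \<in> large_divisors (p * q)"
      using mem_large_divisors_iff[of "p * q" p q] self_mem_large_divisors[of "p * q"] p1 q1 pq by auto
  qed
  also have "\<dots> = {q + i * (p * q - q) | i. i < 2}"
  proof -
    have "{q + i * c | i. i < (2::nat)} = {q, q + c}" for c
    proof -
      have "{i. i < (2::nat)} = {0, 1}" by auto
      then show ?thesis by (simp add: setcompr_eq_image)
    qed
    moreover have "q + (p * q - q) = p * q" using p1 by simp
    ultimately show ?thesis by (simp only:)
  qed
  finally show ?thesis unfolding forms_AP_def using p1 q1
    by (intro disjI2 exI[of _ q] exI[of _ "p * q - q"] exI[of _ 2] conjI) simp_all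
qed

section \<open>Counting products of two primes\<close>

definition semiprimes_le :: "real \<Rightarrow> nat set" where
  "semiprimes_le x = {n. real n \<le> x \<and> (\<exists>p q. prime p \<and> prime q \<and> p < q \<and> n = p * q)}"

definition semiprime_factor_pairs :: "real \<Rightarrow> (nat \<times> nat) set" where
  "semiprime_factor_pairs x = (SIGMA p:primes_le (sqrt x). primes_le (x / real p) - primes_le (real p))"

text \<open>Unique factorisation, with the smaller factor listed first; p < q and p q \<le> x force p \<le> sqrt x.\<close>
lemma bij_betw_semiprimes:
  "bij_betw (\<lambda>(p, q). p * q) (semiprime_factor_pairs x) (semiprimes_le x)"
proof (rule bij_betwI')
  have pair: "prime p \<and> prime q \<and> p < q \<and> real (p * q) \<le> x" if "(p, q) \<in> semiprime_factor_pairs x" for p q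
  proof -
    have p: "prime p" "prime q" "real q \<le> x / real p" "p < q"
      using that by (auto simp: semiprime_factor_pairs_def primes_le_def)
    then have "real p > 0" using prime_gt_0_nat by auto
    then have "real (p * q) \<le> x" using p(3) by (simp add: field_simps)
    then show ?thesis using p by blast
  qed
  fix u v assume uv: "u \<in> semiprime_factor_pairs x" "v \<in> semiprime_factor_pairs x"
  obtain p q where u: "u = (p, q)" by (cases u)
  obtain p' q' where v: "v = (p', q')" by (cases v)
  have pq: "prime p" "prime q" "p < q" using pair uv(1) u by auto
  have pq': "prime p'" "prime q'" "p' < q'" using pair uv(2) v by auto
  have "p = p' \<and> q = q'" if eq: "p * q = p' * q'"
  proof -
    have "p dvd p' * q'" unfolding eq[symmetric] by simp
    then have "p = p' \<or> p = q'"
      using pq(1) pq'(1,2) by (metis prime_dvd_mult_iff primes_dvd_imp_eq)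
    moreover have "p \<noteq> q'"
    proof
      assume "p = q'"
      then have "q = p'" using eq pq(1) prime_gt_0_nat[of p] by simp
      then show False using pq(3) pq'(3) \<open>p = q'\<close> by simp
    qed
    ultimately show ?thesis using eq pq'(1) prime_gt_0_nat[of p'] by simp
  qed
  then show "((case u of (p, q) \<Rightarrow> p * q) = (case v of (p, q) \<Rightarrow> p * q)) = (u = v)"
    unfolding u v by auto
next
  fix u assume u: "u \<in> semiprime_factor_pairs x"
  obtain p q where pq: "u = (p, q)" by (cases u)
  have p: "prime p" "prime q" "real q \<le> x / real p" "p < q"
    using u pq by (auto simp: semiprime_factor_pairs_def primes_le_def)
  then have "real p > 0" using prime_gt_0_nat by auto
  then have "real (p * q) \<le> x" using p(3) by (simp add: field_simps)
  then show "(case u of (p, q) \<Rightarrow> p * q) \<in> semiprimes_le x"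
    using p pq by (auto simp: semiprimes_le_def)
next
  fix n assume "n \<in> semiprimes_le x"
  then obtain p q where n: "real n \<le> x" "prime p" "prime q" "p < q" "n = p * q"
    by (auto simp: semiprimes_le_def)
  have p0: "p > 0" using n(2) by (rule prime_gt_0_nat)
  have pq_le: "real p * real q \<le> x" using n(1,5) by simp
  have "real p ^ 2 \<le> real p * real q" using n(4) by (simp add: power2_eq_square mult_left_mono)
  then have "real p \<le> sqrt x" using pq_le by (intro real_le_rsqrt) linarith
  moreover have "real q \<le> x / real p" using pq_le p0 by (simp add: field_simps)
  ultimately have "(p, q) \<in> semiprime_factor_pairs x"
    using n by (auto simp: semiprime_factor_pairs_def primes_le_def)
  then show "\<exists>u\<in>semiprime_factor_pairs x. n = (case u of (p, q) \<Rightarrow> p * q)"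
    using n(5) by (intro bexI[of _ "(p, q)"]) auto
qed

definition prime_count_sum :: "real \<Rightarrow> real" where
  "prime_count_sum x = (\<Sum>p\<in>primes_le (sqrt x). prime_count (x / real p))"

text \<open>Dropping the condition p < q overcounts by the sum of \<pi>(p) over primes p \<le> sqrt x, which is at most \<pi>(sqrt x)^2.\<close>
lemma card_semiprimes_bounds:
  "real (card (semiprimes_le x)) \<le> prime_count_sum x"
  "prime_count_sum x - (prime_count (sqrt x))\<^sup>2 \<le> real (card (semiprimes_le x))"
proof -
  let ?D = "\<lambda>p. primes_le (x / real p) - primes_le (real p)"
  have "card (semiprimes_le x) = card (semiprime_factor_pairs x)"
    using bij_betw_same_card[OF bij_betw_semiprimes] by simp
  also have "\<dots> = (\<Sum>p\<in>primes_le (sqrt x). card (?D p))"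
    unfolding semiprime_factor_pairs_def by (simp add: card_SigmaI)
  finally have eq: "real (card (semiprimes_le x)) = (\<Sum>p\<in>primes_le (sqrt x). real (card (?D p)))"
    by simp
  show "real (card (semiprimes_le x)) \<le> prime_count_sum x"
    unfolding eq prime_count_sum_def prime_count_def by (intro sum_mono) (simp add: card_mono)
  have "prime_count_sum x - (prime_count (sqrt x))\<^sup>2 =
      (\<Sum>p\<in>primes_le (sqrt x). prime_count (x / real p) - prime_count (sqrt x))"
    unfolding prime_count_sum_def sum_subtractf by (simp add: power2_eq_square prime_count_def)
  also have "\<dots> \<le> (\<Sum>p\<in>primes_le (sqrt x). real (card (?D p)))"
  proof (rule sum_mono)
    fix p assume "p \<in> primes_le (sqrt x)"
    then have "prime_count (real p) \<le> prime_count (sqrt x)"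
      by (intro prime_count_mono) (auto simp: primes_le_def)
    moreover have "card (primes_le (x / real p)) - card (primes_le (real p)) \<le> card (?D p)"
      by (rule diff_card_le_card_Diff) simp
    ultimately show "prime_count (x / real p) - prime_count (sqrt x) \<le> real (card (?D p))"
      unfolding prime_count_def by linarith
  qed
  finally show "prime_count_sum x - (prime_count (sqrt x))\<^sup>2 \<le> real (card (semiprimes_le x))"
    unfolding eq .
qed

text \<open>The sum of reciprocals grows so slowly that it has the same asymptotics at every g x with
ln (ln (g x)) asymptotic to ln (ln x), for instance at sqrt x.\<close>
lemma prime_recip_sum_scaled:
  assumes "filterlim g at_top at_top" "((\<lambda>x. ln (ln (g x)) / ln (ln x)) \<longlongrightarrow> 1) at_top"
  shows "((\<lambda>x. prime_recip_sum (g x) / ln (ln x)) \<longlongrightarrow> 1) at_top"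
proof -
  have "((\<lambda>x. prime_recip_sum (g x) / ln (ln (g x)) * (ln (ln (g x)) / ln (ln x))) \<longlongrightarrow> 1 * 1) at_top"
    by (intro tendsto_mult assms filterlim_compose[OF prime_recip_sum_asymp])
  then have "((\<lambda>x. prime_recip_sum (g x) / ln (ln (g x)) * (ln (ln (g x)) / ln (ln x))) \<longlongrightarrow> 1) at_top" by simp
  moreover have "\<forall>\<^sub>F x::real in at_top. ln (ln x) > 0" by real_asymp
  then have "\<forall>\<^sub>F x in at_top. ln (ln (g x)) > 0" using assms(1) by (rule eventually_compose_filterlim)
  then have "\<forall>\<^sub>F x in at_top. prime_recip_sum (g x) / ln (ln (g x)) * (ln (ln (g x)) / ln (ln x)) = prime_recip_sum (g x) / ln (ln x)"
    by eventually_elim simp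
  ultimately show ?thesis by (rule Lim_transform_eventually)
qed

lemma prime_count_eventually_bounds:
  assumes d: "d > 0"
  shows "\<forall>\<^sub>F t in at_top. (1 - d) * (t / ln t) \<le> prime_count t \<and> prime_count t \<le> (1 + d) * (t / ln t)"
proof -
  have "\<forall>\<^sub>F t in at_top. prime_count t * ln t / t > 1 - d" "\<forall>\<^sub>F t in at_top. prime_count t * ln t / t < 1 + d"
    using order_tendstoD[OF prime_number_theorem] d by auto
  with eventually_gt_at_top[of 1] show ?thesis
  proof eventually_elim
    case (elim t)
    then have "ln t > 0" "t > 0" by auto
    then show ?case using elim by (simp add: field_simps)
  qed
qed

lemma prime_le_sqrt_bounds:
  assumes "p \<in> primes_le (sqrt x)" "x > 1"
  shows "real p \<ge> 1" "sqrt x \<le> x / real p" "x / real p \<le> x"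
proof -
  show p: "real p \<ge> 1" using assms prime_ge_1_nat by (auto simp: primes_le_def)
  have "real p * sqrt x \<le> sqrt x * sqrt x"
    using assms by (intro mult_right_mono) (auto simp: primes_le_def)
  then show "sqrt x \<le> x / real p" using p assms by (simp add: field_simps)
  have "x * 1 \<le> x * real p" using p assms by (intro mult_left_mono) auto
  then show "x / real p \<le> x" using p assms by (simp add: field_simps)
qed

lemma normalise_mono:
  fixes a b x :: real
  assumes "a \<le> b" "x > 1 \<and> ln (ln x) > 0"
  shows "a * ln x / (x * ln (ln x)) \<le> b * ln x / (x * ln (ln x))"
  using assms by (intro divide_right_mono mult_right_mono) auto

text \<open>For the lower bound ln (x/p) \<le> ln x suffices. For the upper bound the range is cut at
y = x powr (1 / ln (ln x)): up to y the logarithm ln (x/p) is (1 - o(1)) ln x, while between y and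
sqrt x it is at least ln x / 2 and the reciprocals of the primes there sum to only o(ln (ln x)).\<close>
theorem prime_count_sum_asymp:
  "((\<lambda>x. prime_count_sum x * ln x / (x * ln (ln x))) \<longlongrightarrow> 1) at_top"
proof -
  let ?A = "\<lambda>x. prime_count_sum x * ln x / (x * ln (ln x))"
  let ?y = "\<lambda>x::real. exp (ln x / ln (ln x))"
  have sq: "filterlim sqrt at_top at_top" by real_asymp
  have T1: "((\<lambda>x. prime_recip_sum (sqrt x) / ln (ln x)) \<longlongrightarrow> 1) at_top"
    by (rule prime_recip_sum_scaled) real_asymp+
  have T2: "((\<lambda>x. prime_recip_sum (?y x) / ln (ln x)) \<longlongrightarrow> 1) at_top"
    by (rule prime_recip_sum_scaled) real_asymp+
  have big: "\<forall>\<^sub>F x::real in at_top. ln (ln x) > 1" by real_asymp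
  have lower: "\<forall>\<^sub>F x in at_top. (1 - d) * (prime_recip_sum (sqrt x) / ln (ln x)) \<le> ?A x" if d: "0 < d" "d < 1" for d
  proof -
    obtain t0 where t0: "\<And>t. t \<ge> t0 \<Longrightarrow> (1 - d) * (t / ln t) \<le> prime_count t"
      using prime_count_eventually_bounds[OF d(1)] unfolding eventually_at_top_linorder by blast
    have "\<forall>\<^sub>F x in at_top. sqrt x \<ge> t0" using sq by (auto simp: filterlim_at_top)
    with big eventually_gt_at_top[of 1] show ?thesis
    proof eventually_elim
      case (elim x)
      have lnx: "ln x > 0" using elim by simp
      have "(1 - d) * (x / ln x) * prime_recip_sum (sqrt x) = 
          (\<Sum>p\<in>primes_le (sqrt x). (1 - d) * (x / ln x) * (1 / real p))"
        unfolding prime_recip_sum_def sum_distrib_left ..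
      also have "\<dots> \<le> prime_count_sum x" unfolding prime_count_sum_def
      proof (rule sum_mono)
        fix p assume p: "p \<in> primes_le (sqrt x)"
        note b = prime_le_sqrt_bounds[OF p elim(2)]
        have t: "x / real p > 1" using b(2) elim(2) real_sqrt_gt_1_iff[of x] by linarith
        have lt: "0 < ln (x / real p)" "ln (x / real p) \<le> ln x" using t b(3) by (auto intro: ln_mono)
        have "(1 - d) * (x / ln x) * (1 / real p) = (1 - d) * (x / real p / ln x)" by simp
        also have "\<dots> \<le> (1 - d) * (x / real p / ln (x / real p))"
          using d lt t lnx by (intro mult_left_mono divide_left_mono mult_pos_pos) auto
        also have "\<dots> \<le> prime_count (x / real p)" using b(2) elim(3) by (intro t0) linarith
        finally show "(1 - d) * (x / ln x) * (1 / real p) \<le> prime_count (x / real p)" .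
      qed
      finally have "(1 - d) * (x / ln x) * prime_recip_sum (sqrt x) * ln x / (x * ln (ln x)) \<le> ?A x"
        by (rule normalise_mono) (use elim in \<open>intro conjI; linarith\<close>)
      then show ?case using elim lnx by simp
    qed
  qed
  have upper: "\<forall>\<^sub>F x in at_top. ?A x \<le> (1 + d) * (prime_recip_sum (?y x) / ln (ln x) * (1 / (1 - 1 / ln (ln x))) 
      + 2 * (prime_recip_sum (sqrt x) / ln (ln x) - prime_recip_sum (?y x) / ln (ln x)))" if d: "0 < d" for d
  proof -
    obtain t0 where t0: "\<And>t. t \<ge> t0 \<Longrightarrow> prime_count t \<le> (1 + d) * (t / ln t)"
      using prime_count_eventually_bounds[OF d(1)] unfolding eventually_at_top_linorder by blast
    have ev1: "\<forall>\<^sub>F x in at_top. sqrt x \<ge> t0" using sq by (auto simp: filterlim_at_top)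
    have ev2: "\<forall>\<^sub>F x::real in at_top. ?y x \<le> sqrt x" by real_asymp
    show ?thesis using big eventually_gt_at_top[of 1] ev1 ev2
    proof eventually_elim
      case (elim x)
      define L where "L = ln (ln x)"
      have L: "L > 1" using elim by (simp add: L_def)
      have lnx: "ln x > 0" using elim by simp
      let ?P = "primes_le (sqrt x)" and ?Q = "primes_le (?y x)"
      have QP: "?Q \<subseteq> ?P" by (intro primes_le_mono elim)
      have gen: "prime_count (x / real p) \<le> (1 + d) * (x / ln x) * c * (1 / real p)"
        if p: "p \<in> ?P" and c: "c > 0" "ln (x / real p) \<ge> ln x / c" for p c
      proof -
        note b = prime_le_sqrt_bounds[OF p elim(2)]
        have "prime_count (x / real p) \<le> (1 + d) * (x / real p / ln (x / real p))"
          using b(2) elim(3) by (intro t0) linarith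
        also have "\<dots> \<le> (1 + d) * (x / real p / (ln x / c))"
        proof -
          have pos: "0 < ln x / c" using lnx c by simp
          then have "0 < ln (x / real p)" using c by linarith
          then show ?thesis using d c pos elim b by (intro mult_left_mono divide_left_mono) auto
        qed
        also have "\<dots> = (1 + d) * (x / ln x) * c * (1 / real p)" by (simp add: mult_ac)
        finally show ?thesis .
      qed
      have "prime_count_sum x = (\<Sum>p\<in>?P - ?Q. prime_count (x / real p)) + (\<Sum>p\<in>?Q. prime_count (x / real p))"
        unfolding prime_count_sum_def by (rule sum.subset_diff[OF QP]) simp
      also have "\<dots> \<le> (\<Sum>p\<in>?P - ?Q. (1 + d) * (x / ln x) * 2 * (1 / real p)) + 
          (\<Sum>p\<in>?Q. (1 + d) * (x / ln x) * (1 / (1 - 1 / L)) * (1 / real p))"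
      proof (intro add_mono sum_mono gen)
        fix p assume "p \<in> ?P - ?Q"
        then show p: "p \<in> ?P" by simp
        note b = prime_le_sqrt_bounds[OF p elim(2)]
        have "ln (sqrt x) \<le> ln (x / real p)" using b(2) elim by (intro ln_mono) auto
        then show "ln x / 2 \<le> ln (x / real p)" using elim by (simp add: ln_sqrt)
      next
        fix p assume p: "p \<in> ?Q"
        then show p': "p \<in> ?P" using QP by blast
        note b = prime_le_sqrt_bounds[OF p' elim(2)]
        have "real p \<le> ?y x" using p by (simp add: primes_le_def)
        then have "ln (real p) \<le> ln (?y x)" using b(1) by (intro ln_mono) auto
        then have "ln (real p) \<le> ln x / L" by (simp add: L_def)
        moreover have "ln (x / real p) = ln x - ln (real p)" using b(1) elim by (simp add: ln_div)
        moreover have "ln x / (1 / (1 - 1 / L)) = ln x - ln x / L" by (simp add: algebra_simps)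
        ultimately show "ln x / (1 / (1 - 1 / L)) \<le> ln (x / real p)" by linarith
      qed (use L in auto)
      also have "\<dots> = (1 + d) * (x / ln x) * (2 * (prime_recip_sum (sqrt x) - prime_recip_sum (?y x)) + 
          (1 / (1 - 1 / L)) * prime_recip_sum (?y x))"
      proof -
        have "prime_recip_sum (sqrt x) - prime_recip_sum (?y x) = (\<Sum>p\<in>?P - ?Q. 1 / real p)"
          unfolding prime_recip_sum_def using QP by (simp add: sum_diff)
        then show ?thesis unfolding prime_recip_sum_def[of "?y x"]
          by (simp only: sum_distrib_left distrib_left mult.assoc)
      qed
      finally have "?A x \<le> (1 + d) * (x / ln x) * (2 * (prime_recip_sum (sqrt x) - prime_recip_sum (?y x)) + 
          (1 / (1 - 1 / L)) * prime_recip_sum (?y x)) * ln x / (x * L)"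
        unfolding L_def[symmetric] using elim lnx L by (intro divide_right_mono mult_right_mono) auto
      also have "\<dots> = (1 + d) * (prime_recip_sum (?y x) / L * (1 / (1 - 1 / L)) 
        + 2 * (prime_recip_sum (sqrt x) / L - prime_recip_sum (?y x) / L))"
      proof -
        have gen: "D * (x / ln x) * (2 * (a - b) + e * b) * ln x / (x * L) = D * (b / L * e + 2 * (a / L - b / L))"
          for a b e D using elim lnx L by (simp add: field_simps)
        show ?thesis by (rule gen)
      qed
      finally show ?case unfolding L_def .
    qed
  qed
  show ?thesis
  proof (rule order_tendstoI)
    fix a :: real assume a: "a < 1"
    define d where "d = min (1 / 2) ((1 - a) / 2)"
    have d: "0 < d" "d < 1" "a < 1 - d" using a by (auto simp: d_def min_def field_simps)
    have "((\<lambda>x. (1 - d) * (prime_recip_sum (sqrt x) / ln (ln x))) \<longlongrightarrow> (1 - d) * 1) at_top"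
      by (intro tendsto_mult tendsto_const T1)
    then have "\<forall>\<^sub>F x in at_top. a < (1 - d) * (prime_recip_sum (sqrt x) / ln (ln x))"
      by (rule order_tendstoD(1)) (use d in simp)
    with lower[OF d(1,2)] show "\<forall>\<^sub>F x in at_top. a < ?A x"
      by eventually_elim linarith
  next
    fix a :: real assume a: "a > 1"
    define d where "d = (a - 1) / 2"
    have d: "0 < d" "1 + d < a" using a by (auto simp: d_def field_simps)
    have "((\<lambda>x. (1 + d) * (prime_recip_sum (?y x) / ln (ln x) * (1 / (1 - 1 / ln (ln x))) 
      + 2 * (prime_recip_sum (sqrt x) / ln (ln x) - prime_recip_sum (?y x) / ln (ln x)))) \<longlongrightarrow> 
      (1 + d) * (1 * 1 + 2 * (1 - 1))) at_top"
      by (intro tendsto_intros T1 T2) real_asymp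
    then have "\<forall>\<^sub>F x in at_top. (1 + d) * (prime_recip_sum (?y x) / ln (ln x) * (1 / (1 - 1 / ln (ln x))) 
      + 2 * (prime_recip_sum (sqrt x) / ln (ln x) - prime_recip_sum (?y x) / ln (ln x))) < a"
      by (rule order_tendstoD(2)) (use d in simp)
    with upper[OF d(1)] show "\<forall>\<^sub>F x in at_top. ?A x < a"
      by eventually_elim linarith
  qed
qed

theorem semiprimes_asymp:
  "((\<lambda>x. real (card (semiprimes_le x)) * ln x / (x * ln (ln x))) \<longlongrightarrow> 1) at_top"
proof (rule tendsto_sandwich)
  let ?c = "\<lambda>x::real. ln x / (x * ln (ln x))"
  have pos: "\<forall>\<^sub>F x::real in at_top. x > 1 \<and> ln (ln x) > 0"
    by (intro eventually_conj eventually_gt_at_top) real_asymp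
  show "\<forall>\<^sub>F x in at_top. real (card (semiprimes_le x)) * ln x / (x * ln (ln x)) \<le> prime_count_sum x * ln x / (x * ln (ln x))"
    using pos by (rule eventually_mono) (intro normalise_mono card_semiprimes_bounds; simp)
  show "\<forall>\<^sub>F x in at_top. (prime_count_sum x - (prime_count (sqrt x))\<^sup>2) * ln x / (x * ln (ln x)) \<le> real (card (semiprimes_le x)) * ln x / (x * ln (ln x))"
    using pos by (rule eventually_mono) (intro normalise_mono card_semiprimes_bounds; simp)
  have sq: "filterlim sqrt at_top at_top" by real_asymp
  have "((\<lambda>x. (prime_count (sqrt x) * ln (sqrt x) / sqrt x)\<^sup>2 * (ln x / ((ln (sqrt x))\<^sup>2 * ln (ln x)))) \<longlongrightarrow> 1\<^sup>2 * 0) at_top"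
    by (intro tendsto_mult tendsto_power filterlim_compose[OF prime_number_theorem sq]) real_asymp
  moreover have "\<forall>\<^sub>F x in at_top. (prime_count (sqrt x) * ln (sqrt x) / sqrt x)\<^sup>2 * (ln x / ((ln (sqrt x))\<^sup>2 * ln (ln x))) = 
     (prime_count (sqrt x))\<^sup>2 * ln x / (x * ln (ln x))"
    using pos
  proof eventually_elim
    case (elim x)
    then have "ln (sqrt x) > 0" by simp
    then show ?case using elim by (simp add: power_mult_distrib power_divide)
  qed
  ultimately have "((\<lambda>x. (prime_count (sqrt x))\<^sup>2 * ln x / (x * ln (ln x))) \<longlongrightarrow> 0) at_top"
    using Lim_transform_eventually by fastforce
  from tendsto_diff[OF prime_count_sum_asymp this]
  show "((\<lambda>x. (prime_count_sum x - (prime_count (sqrt x))\<^sup>2) * ln x / (x * ln (ln x))) \<longlongrightarrow> 1) at_top"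
    by (simp add: left_diff_distrib diff_divide_distrib)
qed (rule prime_count_sum_asymp)

text \<open>Besides the products of two distinct primes only 1, p, p^2 and p^3 occur, and each power \<le> x comes from a prime \<le> x.\<close>
lemma count_large_AP_bounds:
  assumes x: "x \<ge> 0"
  shows "real (card (semiprimes_le x)) \<le> real (count_large_AP x)"
    and "real (count_large_AP x) \<le> real (card (semiprimes_le x)) + 3 * prime_count x + 1"
proof -
  let ?C = "{n. 0 < n \<and> real n \<le> x \<and> forms_AP (large_divisors n)}"
  have fin: "finite ?C" by (rule finite_subset[OF _ finite_nat_real_le[of x]]) auto
  have fin': "finite (semiprimes_le x)" unfolding semiprimes_le_def
    by (rule finite_subset[OF _ finite_nat_real_le[of x]]) auto
  have "semiprimes_le x \<subseteq> ?C"
  proof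
    fix n assume "n \<in> semiprimes_le x"
    then obtain p q where n: "real n \<le> x" "prime p" "prime q" "p < q" "n = p * q"
      by (auto simp: semiprimes_le_def)
    moreover have "n > 0" using n prime_gt_0_nat by auto
    ultimately show "n \<in> ?C" using semiprime_large_divisors_AP by auto
  qed
  then show "real (card (semiprimes_le x)) \<le> real (count_large_AP x)"
    unfolding count_large_AP_def using fin by (simp add: card_mono)
  let ?P = "primes_le x"
  have pow: "p \<in> ?P" if "prime p" "real (p ^ k) \<le> x" "k > 0" for p k
  proof -
    have "p \<le> p ^ k" using that prime_ge_1_nat[of p] by (intro self_le_power) auto
    then have "real p \<le> real (p ^ k)" by (simp only: of_nat_le_iff)
    also note that(2)
    finally show ?thesis using that(1) by (simp add: primes_le_def)
  qed
  have "?C \<subseteq> semiprimes_le x \<union> (?P \<union> ((\<lambda>p. p ^ 2) ` ?P \<union> ((\<lambda>p. p ^ 3) ` ?P \<union> {1})))"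
  proof
    fix n assume n: "n \<in> ?C"
    show "n \<in> semiprimes_le x \<union> (?P \<union> ((\<lambda>p. p ^ 2) ` ?P \<union> ((\<lambda>p. p ^ 3) ` ?P \<union> {1})))"
    proof (cases "n = 1")
      case False
      then have "n > 1" "card (large_divisors n) \<le> 2"
        using n large_divisors_AP_card[of n] by auto
      from large_divisors_card_le_2[OF this] show ?thesis
      proof (elim disjE exE conjE)
        assume "prime n"
        then show ?thesis using n by (simp add: primes_le_def)
      next
        fix p assume p: "prime p" "n = p ^ 2"
        then have "p \<in> ?P" using n pow[of p 2] by simp
        then show ?thesis using p by blast
      next
        fix p assume p: "prime p" "n = p ^ 3"
        then have "p \<in> ?P" using n pow[of p 3] by simp
        then show ?thesis using p by blast
      next
        fix p q assume "prime p" "prime q" "p < q" "n = p * q"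
        then have "n \<in> semiprimes_le x" using n unfolding semiprimes_le_def by blast
        then show ?thesis by blast
      qed
    qed simp
  qed
  then have "card ?C \<le> card (semiprimes_le x \<union> (?P \<union> ((\<lambda>p. p ^ 2) ` ?P \<union> ((\<lambda>p. p ^ 3) ` ?P \<union> {1}))))"
    using fin' by (intro card_mono) auto
  also have "\<dots> \<le> card (semiprimes_le x) + (card ?P + (card ((\<lambda>p. p ^ 2) ` ?P) + (card ((\<lambda>p. p ^ 3) ` ?P) + card {1::nat})))"
    by (intro order_trans[OF card_Un_le] add_left_mono order_refl)
  also have "\<dots> \<le> card (semiprimes_le x) + (card ?P + (card ?P + (card ?P + 1)))"
    by (intro add_mono order_refl card_image_le) auto
  finally show "real (count_large_AP x) \<le> real (card (semiprimes_le x)) + 3 * prime_count x + 1"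
    unfolding count_large_AP_def prime_count_def by linarith
qed

theorem mainTheorem3:
  shows "(\<lambda>x::real. real (count_large_AP x)) \<sim>[at_top] (\<lambda>x. x * ln (ln x) / ln x)"
proof (rule asymp_equivI')
  have pos: "\<forall>\<^sub>F x::real in at_top. x > 1 \<and> ln (ln x) > 0"
    by (intro eventually_conj eventually_gt_at_top) real_asymp
  have "((\<lambda>x. real (count_large_AP x) * ln x / (x * ln (ln x))) \<longlongrightarrow> 1) at_top"
  proof (rule tendsto_sandwich)
    show "\<forall>\<^sub>F x in at_top. real (card (semiprimes_le x)) * ln x / (x * ln (ln x)) \<le> real (count_large_AP x) * ln x / (x * ln (ln x))"
      using pos by (rule eventually_mono) (intro normalise_mono count_large_AP_bounds; simp)
    show "\<forall>\<^sub>F x in at_top. real (count_large_AP x) * ln x / (x * ln (ln x)) \<le> 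
        (real (card (semiprimes_le x)) + 3 * prime_count x + 1) * ln x / (x * ln (ln x))"
      using pos by (rule eventually_mono) (intro normalise_mono count_large_AP_bounds; simp)
    have "((\<lambda>x. real (card (semiprimes_le x)) * ln x / (x * ln (ln x)) 
       + (3 * (prime_count x * ln x / x) * (1 / ln (ln x)) + ln x / (x * ln (ln x)))) \<longlongrightarrow> 1 + (3 * 1 * 0 + 0)) at_top"
      by (intro tendsto_add tendsto_mult tendsto_const semiprimes_asymp prime_number_theorem) real_asymp+
    moreover have "\<forall>\<^sub>F x in at_top. real (card (semiprimes_le x)) * ln x / (x * ln (ln x)) 
       + (3 * (prime_count x * ln x / x) * (1 / ln (ln x)) + ln x / (x * ln (ln x))) = 
       (real (card (semiprimes_le x)) + 3 * prime_count x + 1) * ln x / (x * ln (ln x))"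
      by (intro always_eventually allI) (simp add: add_divide_distrib distrib_right)
    ultimately show "((\<lambda>x. (real (card (semiprimes_le x)) + 3 * prime_count x + 1) * ln x / (x * ln (ln x))) \<longlongrightarrow> 1) at_top"
      using Lim_transform_eventually by fastforce
  qed (rule semiprimes_asymp)
  then show "((\<lambda>x. real (count_large_AP x) / (x * ln (ln x) / ln x)) \<longlongrightarrow> 1) at_top"
    by simp
qed

end
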